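(* Let $\beta>0$ and consider the Uniform Gram determinant process $\Delta^{G,\beta}_n$ defined in the context. Then: (1) $\displaystyle\lim_{n\to\infty}\sup_{p\le n}\Big|\frac1n\mathbb E\log\Delta^{G,\beta}_{n,p}+\mathcal J\Big(1-\frac pn\Big)\Big|=0$. (2) For every $t\in[0,1)$, $\mathbb E\log\Delta^{G,\beta}_n(t)+n\mathcal J\big(1-\frac{\lfloor nt\rfloor}{n}\big)\to\int_0^t \mathtt d^{G,\beta}(s)\,ds$, and $\mathbb E\log\Delta^{G,\beta}_n(1)+n+\big(\frac1\beta-\frac12\big)\log n\to K^1_\beta$. (3) For every $t\in[0,1)$, $\mathrm{Var}\log\Delta^{G,\beta}_n(t)\to\int_0^t(\sigma^{G,\beta}(s))^2\,ds$, and $\mathrm{Var}\log\Delta^{G,\beta}_n(1)-\frac2\beta\log n\to K^2_\beta$. (4) $\displaystyle\sup_{t\in[0,1]}\Big|\frac1n\log\Delta^{G,\beta}_n(t)+\mathcal J(1-t)\Big|\to0$ in probability.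
   Context: $\beta'=\beta/2$. For each $n\ge1$ let $\rho^{G,\beta}_{1,n}:=1$ and let $\rho^{G,\beta}_{k,n}$, $k=2,\dots,n$, be independent with $\rho^{G,\beta}_{k,n}\sim\mathrm{Beta}(\beta'(n-k+1),\beta'(k-1))$. Set $\log\Delta^{G,\beta}_{n,p}=\sum_{k=1}^p\log\rho^{G,\beta}_{k,n}$ for $p\le n$, and $\Delta^{G,\beta}_n(t)=\Delta^{G,\beta}_{n,\lfloor nt\rfloor}$, $t\in[0,1]$. Let $\mathcal J(u)=u\log u-u+1$ for $u>0$, $\mathcal J(0)=1$, $\mathcal J(u)=+\infty$ for $u<0$. Let $\mathtt d^{G,\beta}(t)=\frac1\beta+\big(\frac12-\frac1\beta\big)\frac1{1-t}$ and $\sigma^{G,\beta}(t)=\sqrt{\frac{2t}{\beta(1-t)}}$. Let $f(s)=\big[\frac12-\frac1s+\frac1{e^s-1}\big]\frac1s$ for $s>0$, $\gamma$ the Euler constant, and $K^1_\beta=\frac12\log(2\pi)+\frac{1-\gamma}{\beta}-\int_0^\infty\frac{sf(s)}{e^{\beta s/2}-1}ds$, $K^2_\beta=\frac{2(\gamma-1)}{\beta}+\int_0^\infty\frac{s(sf(s)+\frac12)}{e^{\beta s/2}-1}ds$. *)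

theory Defs
  imports "HOL-Probability.Probability"
begin

definition beta_density :: "real \<Rightarrow> real \<Rightarrow> real \<Rightarrow> real" where
  "beta_density a b x =
     (if 0 < x \<and> x < 1 then x powr (a - 1) * (1 - x) powr (b - 1) / Beta a b else 0)"

text \<open>The rate function J(u) = u log u - u + 1 (u > 0), J(0) = 1. The value +infinity for u < 0
  is never used (all arguments below lie in [0,1]); we put 0 there as a dummy value.\<close>
definition J_rate :: "real \<Rightarrow> real" where
  "J_rate u = (if u > 0 then u * ln u - u + 1 else if u = 0 then 1 else 0)"

definition log_Delta :: "(nat \<Rightarrow> nat \<Rightarrow> 'a \<Rightarrow> real) \<Rightarrow> nat \<Rightarrow> nat \<Rightarrow> 'a \<Rightarrow> real" where
  "log_Delta \<rho> n p x = (\<Sum>k=1..p. ln (\<rho> n k x))"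

definition log_Delta_t :: "(nat \<Rightarrow> nat \<Rightarrow> 'a \<Rightarrow> real) \<Rightarrow> nat \<Rightarrow> real \<Rightarrow> 'a \<Rightarrow> real" where
  "log_Delta_t \<rho> n t x = log_Delta \<rho> n (nat \<lfloor>real n * t\<rfloor>) x"

definition d_G :: "real \<Rightarrow> real \<Rightarrow> real" where
  "d_G \<beta> t = 1 / \<beta> + (1/2 - 1/\<beta>) * (1 / (1 - t))"

definition sigma_G :: "real \<Rightarrow> real \<Rightarrow> real" where
  "sigma_G \<beta> t = sqrt (2 * t / (\<beta> * (1 - t)))"

definition f_aux :: "real \<Rightarrow> real" where
  "f_aux s = (1/2 - 1/s + 1 / (exp s - 1)) * (1 / s)"

definition K1 :: "real \<Rightarrow> real" where
  "K1 \<beta> = 1/2 * ln (2 * pi) + (1 - euler_mascheroni) / \<beta>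
          - integral {0<..} (\<lambda>s. s * f_aux s / (exp (\<beta> * s / 2) - 1))"

definition K2 :: "real \<Rightarrow> real" where
  "K2 \<beta> = 2 * (euler_mascheroni - 1) / \<beta>
          + integral {0<..} (\<lambda>s. s * (s * f_aux s + 1/2) / (exp (\<beta> * s / 2) - 1))"

end

theory Submission
  imports Defs "HOL-Real_Asymp.Real_Asymp"
begin

text \<open>
  Write \<open>b = \<beta> / 2\<close>. If \<open>X\<close> is Beta\<open>(a, c)\<close> distributed, then \<open>ln X\<close> has mean \<open>\<psi>(a) - \<psi>(a + c)\<close> and
  variance \<open>\<psi>'(a) - \<psi>'(a + c)\<close>, so mean and variance of the log-determinant are sums of digamma and trigamma
  values at the lattice points \<open>b j\<close>. Binet's formulas
  \<open>ln x - 1/(2x) - \<psi>(x) = \<integral> s f(s) exp(-x s) ds\<close> and \<open>\<psi>'(x) - 1/x = \<integral> s (s f(s) + 1/2) exp(-x s) ds\<close> have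
  remainders that are \<open>O(1/x\<^sup>2)\<close> and sum over the lattice, by geometric series under the integral, to the
  integrals in \<open>K1\<close> and \<open>K2\<close>; the main terms are \<open>ln n!\<close> (Stirling) and harmonic numbers.
  For the convergence in probability, Chebyshev's inequality and a union bound over \<open>p \<le> n\<close> suffice: the variance is
  \<open>O(ln n)\<close>, so the exceptional event has probability \<open>O(n ln n / n\<^sup>2)\<close>.
\<close>

section \<open>Stirling's formula\<close>

text \<open>Mean and variance satisfy exact identities at finite n (\<open>mean_logdet_eq\<close>,
  \<open>var_logdet_eq\<close>), and all limits are read off from them. Apart from multiples of p,
  they contain only differences \<open>a n - a (n - p)\<close>. For fixed t < 1 both indices tend to
  infinity, so additive constants cancel and only the logarithmic growth of \<open>a\<close>
  survives; this gives the integrals of drift and variance. At p = n the second index is 0 and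
  nothing cancels: the constants of Stirling's formula, of the harmonic numbers and of the remainder
  sums make up \<open>K1\<close> and \<open>K2\<close>. The term 1/(2x) is split off the digamma
  remainder because it is not summable over the lattice; its analogue 1/(2x^2) may stay in the
  trigamma remainder, hence the extra 1/2 in the integrand of \<open>K2\<close>.

  Laplace integrals are taken in \<open>ennreal\<close>: for nonnegative integrands, sums and
  integrals can be exchanged before anything is known to be finite. The price is that signs of
  remainders need separate arguments, since \<open>ennreal\<close> sends negative reals to
  0.\<close>

lemma ln_fact_remainder_convergent:
  "convergent (\<lambda>n. ln (fact n) - (real n * ln (real n) - real n + ln (real n) / 2) :: real)"
proof -
  define d where "d n = ln (fact n) - (real n * ln (real n) - real n + ln (real n) / 2)" for n
  have diff: "d (Suc n) - d (Suc (Suc n)) =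
      (real (Suc n) + 1 / 2) * (ln (real (Suc n) + 1) - ln (real (Suc n))) - 1" for n
    by (simp add: d_def ln_mult fact_Suc algebra_simps del: of_nat_Suc)
       (simp add: algebra_simps ring_distribs add_divide_distrib)
  \<comment> \<open>Midpoint rule for the convex function 1/x on [n+1, n+2]: the remainder
    decreases.\<close>
  have lower: "0 \<le> d (Suc n) - d (Suc (Suc n))" for n
  proof -
    have "2 * 1 / (2 * real (Suc n) + 1) \<le> ln (real (Suc n) + 1) - ln (real (Suc n))"
      using ln_inverse_approx_ge[of "real (Suc n)" "real (Suc n) + 1"] by (simp add: field_simps)
    from mult_left_mono[OF this, of "real (Suc n) + 1 / 2"] show ?thesis
      unfolding diff by (simp add: field_simps)
  qed
  \<comment> \<open>Trapezoidal rule on the same interval: the decrements are at most those of a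
    telescoping sequence, so the remainder is bounded below.\<close>
  have upper: "d (Suc n) - d (Suc (Suc n)) \<le> 1 / 4 * (1 / real (Suc n) - 1 / real (Suc (Suc n)))" for n
  proof -
    define x where "x = real (Suc n)"
    have x: "x > 0" by (simp add: x_def)
    have "ln (x + 1) - ln x \<le> (1 / x + 1 / (x + 1)) / 2"
      using ln_inverse_approx_le[of x 1] x by (simp add: field_simps)
    from mult_left_mono[OF this, of "x + 1 / 2"] x
    have "(x + 1 / 2) * (ln (x + 1) - ln x) - 1 \<le> (x + 1 / 2) * ((1 / x + 1 / (x + 1)) / 2) - 1"
      by simp
    also have "\<dots> = 1 / 4 * (1 / x - 1 / (x + 1))"
      using x by (simp add: divide_simps) (simp add: algebra_simps)
    finally show ?thesis by (simp add: diff x_def add_ac)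
  qed
  have "bounded (range (\<lambda>n. d (Suc n)))"
  proof -
    have lo: "d 1 - 1 / 4 * (1 - 1 / real (Suc n)) \<le> d (Suc n)" for n
    proof (induction n)
      case (Suc n)
      then show ?case using upper[of n] by (simp add: algebra_simps del: of_nat_Suc)
    qed simp
    have hi: "d (Suc n) \<le> d 1" for n
      using lower by (induction n) (auto intro: order_trans simp: algebra_simps)
    have "norm (d (Suc n)) \<le> \<bar>d 1\<bar> + 1" for n
    proof -
      have "1 / 4 * (1 - 1 / real (Suc n)) \<le> 1" by (simp add: field_simps)
      with lo[of n] hi[of n] show ?thesis unfolding real_norm_def by linarith
    qed
    then show ?thesis by (intro boundedI[of _ "\<bar>d 1\<bar> + 1"]) auto
  qed
  moreover have "decseq (\<lambda>n. d (Suc n))"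
    using lower by (intro decseq_SucI) (simp add: algebra_simps)
  ultimately have "convergent (\<lambda>n. d (Suc n))"
    by (intro Bseq_monoseq_convergent) (auto simp: Bseq_eq_bounded decseq_imp_monoseq)
  then have "convergent d" unfolding convergent_Suc_iff .
  then show ?thesis unfolding d_def[abs_def] .
qed

text \<open>Factorials make the logarithm of the partial Wallis product a combination of ln n! and
  ln (2n)!, to which the Stirling remainder at n and at 2n can be applied.\<close>

lemma wallis_fact:
  "(\<Prod>k=1..n. (4 * real k ^ 2) / (4 * real k ^ 2 - 1)) =
     (4 ^ n * fact n ^ 2) ^ 2 / (fact (2 * n) ^ 2 * (2 * real n + 1))"
proof (induction n)
  case (Suc n)
  have alg: "4 * y ^ 2 / (u * v) * (a ^ 2 / (c ^ 2 * u)) = (4 * y ^ 2 * a) ^ 2 / ((2 * y * u * c) ^ 2 * v)"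
    if "y > 0" "u > 0" "v > 0" "c > 0" for y u v a c :: real
    using that by (simp add: divide_simps power2_eq_square)
  have 1: "4 * real (Suc n) ^ 2 - 1 = (2 * real n + 1) * (2 * real n + 3)"
    by (simp add: power2_eq_square algebra_simps)
  have 2: "fact (2 * Suc n) = 2 * real (Suc n) * (2 * real n + 1) * fact (2 * n)"
    by (simp add: algebra_simps)
  have 3: "4 ^ Suc n * fact (Suc n) ^ 2 = 4 * real (Suc n) ^ 2 * (4 ^ n * fact n ^ 2)"
    by (simp only: fact_Suc power_mult_distrib power_Suc of_nat_mult ac_simps)
  have 4: "2 * real (Suc n) + 1 = 2 * real n + 3"
    by simp
  have "(\<Prod>k=1..Suc n. (4 * real k ^ 2) / (4 * real k ^ 2 - 1)) =
      4 * real (Suc n) ^ 2 / (4 * real (Suc n) ^ 2 - 1) *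
      (\<Prod>k=1..n. (4 * real k ^ 2) / (4 * real k ^ 2 - 1))"
    by (simp add: prod.nat_ivl_Suc')
  then show ?case unfolding Suc 1 2 3 4 by (simp only: alg) (subst alg, auto)
qed simp

text \<open>The limit L of the remainder exists, so only its value is missing. In the logarithm of
  the Wallis product the remainders enter as 4 d(n) - 2 d(2n), which tends to 2L; comparison with ln
  (pi/2) determines L.\<close>

theorem ln_fact_stirling:
  "(\<lambda>n. ln (fact n) - (real n * ln (real n) - real n + ln (real n) / 2)) \<longlonglongrightarrow> ln (2 * pi) / 2"
proof -
  define d where "d n = ln (fact n) - (real n * ln (real n) - real n + ln (real n) / 2)" for n
  obtain L where L: "d \<longlonglongrightarrow> L"
    using ln_fact_remainder_convergent unfolding convergent_def d_def by auto
  have L2: "(\<lambda>n. d (2 * n)) \<longlonglongrightarrow> L"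
    using LIMSEQ_subseq_LIMSEQ[OF L, of "\<lambda>n. 2 * n"] by (auto simp: strict_mono_def o_def)
  \<comment> \<open>The bracket collects the logarithms left over once both factorials are replaced
    by main term and remainder; it tends to -2 ln 2.\<close>
  have lim1: "(\<lambda>n. 4 * d n - 2 * d (2 * n) + (2 * ln (real n) - ln (2 * real n) - ln (2 * real n + 1)))
      \<longlonglongrightarrow> 4 * L - 2 * L + - (2 * ln 2)"
    by (intro tendsto_add tendsto_diff tendsto_mult tendsto_const L L2)
       real_asymp
  have lim2: "(\<lambda>n. ln (\<Prod>k=1..n. (4 * real k ^ 2) / (4 * real k ^ 2 - 1))) \<longlonglongrightarrow> ln (pi / 2)"
    by (intro tendsto_ln wallis) simp
  have ev: "\<forall>\<^sub>F n in sequentially. ln (\<Prod>k=1..n. (4 * real k ^ 2) / (4 * real k ^ 2 - 1)) =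
      4 * d n - 2 * d (2 * n) + (2 * ln (real n) - ln (2 * real n) - ln (2 * real n + 1))"
    using eventually_gt_at_top[of 0]
  proof eventually_elim
    case (elim n)
    have 4: "ln (4 :: real) = 2 * ln 2" using ln_realpow[of 2 2] by simp
    have "ln ((4 ^ n * F ^ 2) ^ 2 / (G ^ 2 * x)) = 4 * real n * ln 2 + 4 * ln F - 2 * ln G - ln x"
      if "F > 0" "G > 0" "x > 0" for F G x :: real
      using that by (simp add: ln_div ln_mult ln_realpow 4)
    from this[of "fact n" "fact (2 * n)" "2 * real n + 1"]
    have "ln (\<Prod>k=1..n. (4 * real k ^ 2) / (4 * real k ^ 2 - 1)) =
        4 * real n * ln 2 + 4 * ln (fact n) - 2 * ln (fact (2 * n)) - ln (2 * real n + 1)"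
      unfolding wallis_fact by simp
    moreover have ln_2n: "ln (2 * real n) = ln 2 + ln (real n)"
      using elim by (simp add: ln_mult)
    moreover have "d (2 * n) = ln (fact (2 * n)) -
        (2 * real n * (ln 2 + ln (real n)) - 2 * real n + (ln 2 + ln (real n)) / 2)"
      unfolding d_def of_nat_mult of_nat_numeral ln_2n ..
    moreover have "4 * real n * ln 2 + 4 * F - 2 * G - z =
        4 * (F - (real n * l - real n + l / 2)) -
        2 * (G - (2 * real n * (ln 2 + l) - 2 * real n + (ln 2 + l) / 2)) + (2 * l - (ln 2 + l) - z)"
      for F G z l :: real
      by (simp add: field_simps)
    ultimately show ?case by (simp only: d_def[of n])
  qed
  have "4 * L - 2 * L + - (2 * ln 2) = ln (pi / 2)"
    by (rule LIMSEQ_unique[OF lim1 Lim_transform_eventually[OF lim2 ev]])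
  then have "L = ln (2 * pi) / 2" by (simp add: ln_mult ln_div)
  with L show ?thesis unfolding d_def[abs_def] by simp
qed

section \<open>Binet's formulas for the digamma and trigamma functions\<close>

lemma mult_f_aux: "s \<noteq> 0 \<Longrightarrow> s * f_aux s = 1 / 2 - 1 / s + 1 / (exp s - 1)"
  by (simp add: f_aux_def)

text \<open>Nonnegativity makes the Laplace integrals monotone in \<open>ennreal\<close>. The bound
  1/2 controls the trigamma remainder, and the linear bound, which improves on it near 0, gives the
  digamma remainder its quadratic decay.\<close>

lemma mult_f_aux_bounds:
  assumes "s > 0"
  shows "0 \<le> s * f_aux s" "s * f_aux s \<le> 1 / 2" "s * f_aux s \<le> s / 4"
proof -
  have e: "exp s - 1 > 0" using assms by simp
  \<comment> \<open>The function is the numerator of s f(s) over the common denominator 2 s (exp s -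
    1). It vanishes at 0, and its derivative is nonnegative because 1 - x \<le> exp (-x).\<close>
  have "(0 - 2) * exp 0 + 0 + 2 \<le> (s - 2) * exp s + s + (2::real)"
  proof (rule DERIV_nonneg_imp_nondecreasing[of 0 s "\<lambda>s. (s - 2) * exp s + s + (2::real)"])
    fix x :: real
    have "(1 - x) * exp x \<le> exp (- x) * exp x"
      using exp_ge_add_one_self[of "- x"] by (intro mult_right_mono) auto
    then have "(x - 1) * exp x + 1 \<ge> 0" by (simp add: exp_minus field_simps)
    moreover have "((\<lambda>s. (s - 2) * exp s + s + 2) has_real_derivative (x - 1) * exp x + 1) (at x)"
      by (auto intro!: derivative_eq_intros simp: algebra_simps)
    ultimately show "\<exists>y. ((\<lambda>s. (s - 2) * exp s + s + 2) has_real_derivative y) (at x) \<and> 0 \<le> y"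
      by blast
  qed (use assms in auto)
  then have "0 \<le> ((s - 2) * exp s + s + 2) / (2 * s * (exp s - 1))"
    using assms e by simp
  also have "\<dots> = s * f_aux s"
    using assms e by (simp add: mult_f_aux divide_simps) (simp add: algebra_simps)
  finally show "0 \<le> s * f_aux s" .
  have "1 / (exp s - 1) \<le> 1 / s"
    using assms exp_ge_add_one_self[of s] e by (intro divide_left_mono mult_pos_pos) linarith+
  then show "s * f_aux s \<le> 1 / 2" using assms by (simp add: mult_f_aux)
  \<comment> \<open>The quadratic Taylor term cancels the pole 1/s and leaves 1/2 - 1/(2 + s), which
    is at most s/4.\<close>
  have "s + s\<^sup>2 / 2 \<le> exp s - 1"
    using exp_lower_Taylor_quadratic[of s] assms by simp
  then have "1 / (exp s - 1) \<le> 1 / (s + s\<^sup>2 / 2)"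
    using assms e by (intro divide_left_mono mult_pos_pos) (auto intro!: add_pos_pos)
  also have "\<dots> = 1 / s - 1 / (2 + s)"
  proof -
    have "s * s + s * 2 > 0" using mult_pos_pos[OF assms assms] assms by linarith
    then show ?thesis using assms by (simp add: field_simps power2_eq_square)
  qed
  finally have "s * f_aux s \<le> 1 / 2 - 1 / (2 + s)" using assms by (simp add: mult_f_aux)
  also have "\<dots> \<le> s / 4" using assms by (simp add: field_simps)
  finally show "s * f_aux s \<le> s / 4" .
qed

lemma borel_measurable_f_aux [measurable]: "f_aux \<in> borel_measurable borel"
  unfolding f_aux_def[abs_def] by measurable

text \<open>An \<open>ennreal\<close> value allows Tonelli and termwise integration of series
  without integrability proofs. The integral avoids s = 0, where the divisions in the kernels take
  default values.\<close>

definition nn_laplace :: "(real \<Rightarrow> real) \<Rightarrow> real \<Rightarrow> ennreal" where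
  "nn_laplace g x = (\<integral>\<^sup>+s\<in>{0<..}. ennreal (g s * exp (- x * s)) \<partial>lborel)"

lemma nn_integral_Ioi_eq_Ici:
  "(\<integral>\<^sup>+s\<in>{a<..}. f s \<partial>lborel) = (\<integral>\<^sup>+s\<in>{a..}. f s \<partial>lborel)" for a :: real
proof (rule nn_integral_cong_AE)
  show "AE s in lborel. f s * indicator {a<..} s = f s * indicator {a..} s"
    using AE_lborel_singleton[of a] by eventually_elim (auto simp: indicator_def)
qed

lemma nn_laplace_cong:
  "(\<And>s. s > 0 \<Longrightarrow> g s = h s) \<Longrightarrow> nn_laplace g x = nn_laplace h x"
  unfolding nn_laplace_def by (intro nn_integral_cong) (auto split: split_indicator)

lemma nn_laplace_mono:
  "(\<And>s. s > 0 \<Longrightarrow> g s \<le> h s) \<Longrightarrow> nn_laplace g x \<le> nn_laplace h x"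
  unfolding nn_laplace_def
  by (intro nn_integral_mono) (auto split: split_indicator intro!: ennreal_leI)

lemma nn_laplace_add:
  assumes [measurable]: "g \<in> borel_measurable borel" "h \<in> borel_measurable borel"
    and "\<And>s. s > 0 \<Longrightarrow> g s \<ge> 0" "\<And>s. s > 0 \<Longrightarrow> h s \<ge> 0"
  shows "nn_laplace (\<lambda>s. g s + h s) x = nn_laplace g x + nn_laplace h x"
proof -
  have "nn_laplace (\<lambda>s. g s + h s) x =
      (\<integral>\<^sup>+s. ennreal (g s * exp (- x * s)) * indicator {0<..} s
           + ennreal (h s * exp (- x * s)) * indicator {0<..} s \<partial>lborel)"
    unfolding nn_laplace_def using assms(3,4)
    by (intro nn_integral_cong) (auto split: split_indicator simp: distrib_right ennreal_plus)
  also have "\<dots> = nn_laplace g x + nn_laplace h x"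
    unfolding nn_laplace_def by (subst nn_integral_add) auto
  finally show ?thesis .
qed

lemma nn_laplace_cmult:
  assumes [measurable]: "g \<in> borel_measurable borel" and "c \<ge> 0"
  shows "nn_laplace (\<lambda>s. c * g s) x = ennreal c * nn_laplace g x"
  unfolding nn_laplace_def
  by (subst nn_integral_cmult[symmetric])
     (auto simp: ennreal_mult' assms mult.assoc intro!: nn_integral_cong)

lemma nn_laplace_const:
  assumes "x > 0"
  shows "nn_laplace (\<lambda>_. 1) x = ennreal (1 / x)"
proof -
  have "nn_laplace (\<lambda>_. 1) x = (\<integral>\<^sup>+s\<in>{0..}. ennreal (exp (- x * s)) \<partial>lborel)"
    unfolding nn_laplace_def nn_integral_Ioi_eq_Ici by simp
  also have "\<dots> = ennreal (0 - (- exp (- x * 0) / x))"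
    using assms
    by (intro nn_integral_FTC_atLeast)
       (auto intro!: derivative_eq_intros, real_asymp)
  finally show ?thesis by simp
qed

lemma nn_laplace_ident:
  assumes "x > 0"
  shows "nn_laplace (\<lambda>s. s) x = ennreal (1 / x\<^sup>2)"
proof -
  have "nn_laplace (\<lambda>s. s) x = (\<integral>\<^sup>+s\<in>{0..}. ennreal (s * exp (- x * s)) \<partial>lborel)"
    unfolding nn_laplace_def nn_integral_Ioi_eq_Ici by simp
  also have "\<dots> = ennreal (0 - (- (0 / x + 1 / x\<^sup>2) * exp (- x * 0)))"
  proof (intro nn_integral_FTC_atLeast)
    show "((\<lambda>s. - (s / x + 1 / x\<^sup>2) * exp (- x * s)) has_real_derivative s * exp (- x * s)) (at s)" for s
      using assms by (auto intro!: derivative_eq_intros simp: field_simps power2_eq_square)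
    show "((\<lambda>s. - (s / x + 1 / x\<^sup>2) * exp (- x * s)) \<longlongrightarrow> 0) at_top"
      using assms by real_asymp
  qed auto
  finally show ?thesis by simp
qed

lemma nn_laplace_linear:
  assumes "x > 0" "c \<ge> 0"
  shows "nn_laplace (\<lambda>s. c * s) x = ennreal (c / x\<^sup>2)"
  using assms ennreal_mult'[of c "1 / x\<^sup>2"]
  by (subst nn_laplace_cmult) (simp_all add: nn_laplace_ident)

text \<open>Expanding 1/(1 - exp (-s)) as a geometric series shifts x to x + k; each term transforms
  to 1/(x + k)^2, and these are the terms of the trigamma series.\<close>

lemma trigamma_eq_nn_laplace:
  assumes x: "x > 0"
  shows "nn_laplace (\<lambda>s. s / (1 - exp (- s))) x = ennreal (Polygamma 1 x)"
proof -
  have sums: "(\<lambda>k. 1 / (x + real k)\<^sup>2) sums Polygamma 1 x"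
    using Polygamma_LIMSEQ[of x 1] x by (simp add: inverse_eq_divide numeral_2_eq_2)
  have "nn_laplace (\<lambda>s. s / (1 - exp (- s))) x =
      (\<integral>\<^sup>+s. (\<Sum>k. ennreal (s * exp (- (x + real k) * s)) * indicator {0<..} s) \<partial>lborel)"
    unfolding nn_laplace_def
  proof (intro nn_integral_cong)
    fix s :: real
    show "ennreal (s / (1 - exp (- s)) * exp (- x * s)) * indicator {0<..} s =
        (\<Sum>k. ennreal (s * exp (- (x + real k) * s)) * indicator {0<..} s)"
    proof (cases "s > 0")
      case True
      have "(\<lambda>k. exp (- s) ^ k) sums (1 / (1 - exp (- s)))"
        using True by (intro geometric_sums) simp
      then have "(\<lambda>k. s * exp (- x * s) * exp (- s) ^ k) sums (s * exp (- x * s) * (1 / (1 - exp (- s))))"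
        by (intro sums_mult)
      moreover have "s * exp (- x * s) * exp (- s) ^ k = s * exp (- (x + real k) * s)" for k
        by (simp add: exp_of_nat_mult[symmetric] exp_add[symmetric] algebra_simps)
      ultimately have "(\<lambda>k. s * exp (- (x + real k) * s)) sums (s / (1 - exp (- s)) * exp (- x * s))"
        by (simp only:) (simp add: mult_ac)
      then have "(\<Sum>k. ennreal (s * exp (- (x + real k) * s))) = ennreal (s / (1 - exp (- s)) * exp (- x * s))"
        using True by (intro suminf_ennreal_eq) auto
      then show ?thesis using True by simp
    qed auto
  qed
  also have "\<dots> = (\<Sum>k. nn_laplace (\<lambda>s. s) (x + real k))"
    unfolding nn_laplace_def by (subst nn_integral_suminf) auto
  also have "\<dots> = (\<Sum>k. ennreal (1 / (x + real k)\<^sup>2))"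
    using x by (subst nn_laplace_ident) (auto intro: add_pos_nonneg)
  also have "\<dots> = ennreal (Polygamma 1 x)"
    using sums by (intro suminf_ennreal_eq) auto
  finally show ?thesis .
qed

text \<open>Only 1/x is removed: summed over the lattice it produces harmonic numbers, while the
  next term 1/(2x^2) is already summable.\<close>

definition trigamma_rem :: "real \<Rightarrow> real" where
  "trigamma_rem x = Polygamma 1 x - 1 / x"

text \<open>The sign is chosen so that the Laplace density s f(s) is nonnegative. Removing 1/(2x) as
  well leaves a quantity summable over the lattice.\<close>

definition digamma_rem :: "real \<Rightarrow> real" where
  "digamma_rem x = ln x - 1 / (2 * x) - Digamma x"

lemma ennreal_plus_eqD:
  assumes "ennreal a + z = ennreal b" "0 \<le> a"
  shows "z = ennreal (b - a)"
  using assms by (metis ennreal_add_diff_cancel_left ennreal_minus ennreal_neq_top)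

text \<open>The trigamma density s/(1 - exp (-s)) equals 1 + s (s f(s) + 1/2), and the constant 1
  transforms to the 1/x that \<open>trigamma_rem\<close> removes.\<close>

lemma trigamma_rem_nn_laplace:
  assumes x: "x > 0"
  shows "nn_laplace (\<lambda>s. s * (s * f_aux s + 1 / 2)) x = ennreal (trigamma_rem x)"
proof -
  have *: "s / (1 - exp (- s)) = 1 + s * (s * f_aux s + 1 / 2)" if "s > 0" for s :: real
  proof -
    have "exp s > 1" using that by simp
    moreover have "1 - exp (- s) = (exp s - 1) / exp s" by (simp add: exp_minus field_simps)
    ultimately show ?thesis using that by (simp add: mult_f_aux field_simps)
  qed
  have "nn_laplace (\<lambda>s. 1 + s * (s * f_aux s + 1 / 2)) x = ennreal (Polygamma 1 x)"
    using nn_laplace_cong[OF *] trigamma_eq_nn_laplace[OF x] by simp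
  moreover have "s * (s * f_aux s + 1 / 2) \<ge> 0" if "s > 0" for s
    using mult_f_aux_bounds(1)[OF that] that by simp
  ultimately have "ennreal (1 / x) + nn_laplace (\<lambda>s. s * (s * f_aux s + 1 / 2)) x = ennreal (Polygamma 1 x)"
    using nn_laplace_const[OF x] by (subst (asm) nn_laplace_add) auto
  then show ?thesis unfolding trigamma_rem_def using x by (intro ennreal_plus_eqD) auto
qed

text \<open>From 0 \<le> s f(s) \<le> 1/2 the density lies between s/2 and s. The upper bound gives
  summability over the lattice; the lower bound gives the sign of the derivative of
  \<open>digamma_rem\<close>.\<close>

lemma trigamma_rem_bounds:
  assumes x: "x > 0"
  shows "1 / (2 * x\<^sup>2) \<le> trigamma_rem x" "trigamma_rem x \<le> 1 / x\<^sup>2"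
proof -
  have half: "ennreal (1 / (2 * x\<^sup>2)) = nn_laplace (\<lambda>s. 1 / 2 * s) x"
    using nn_laplace_linear[OF x, of "1 / 2"] by simp
  also have "\<dots> \<le> nn_laplace (\<lambda>s. s * (s * f_aux s + 1 / 2)) x"
    using mult_f_aux_bounds(1) by (intro nn_laplace_mono) (auto simp: algebra_simps)
  also have "\<dots> = ennreal (trigamma_rem x)" by (rule trigamma_rem_nn_laplace[OF x])
  \<comment> \<open>An inequality in \<open>ennreal\<close> says nothing about a negative right side
    in general; here the positive left side excludes that case.\<close>
  finally show l: "1 / (2 * x\<^sup>2) \<le> trigamma_rem x"
    using x by (subst (asm) ennreal_le_iff2) (auto simp: not_le field_simps)
  have "ennreal (trigamma_rem x) = nn_laplace (\<lambda>s. s * (s * f_aux s + 1 / 2)) x"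
    by (rule trigamma_rem_nn_laplace[OF x, symmetric])
  also have "\<dots> \<le> nn_laplace (\<lambda>s. s) x"
  proof (intro nn_laplace_mono)
    fix s :: real assume s: "s > 0"
    have "s * (s * f_aux s + 1 / 2) \<le> s * 1"
      using mult_f_aux_bounds(2)[OF s] s by (intro mult_left_mono) auto
    then show "s * (s * f_aux s + 1 / 2) \<le> s" by simp
  qed
  also have "\<dots> = ennreal (1 / x\<^sup>2)" by (rule nn_laplace_ident[OF x])
  finally show "trigamma_rem x \<le> 1 / x\<^sup>2" by (subst (asm) ennreal_le_iff) auto
qed

lemma trigamma_rem_nonneg: "x > 0 \<Longrightarrow> 0 \<le> trigamma_rem x"
  by (rule order_trans[OF _ trigamma_rem_bounds(1)]) simp_all

text \<open>By the mean value theorem ln x = ln Gamma(x+1) - ln Gamma(x) is a digamma value at a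
  point between x and x+1. Since digamma increases, it lies between Digamma x and Digamma (x+1) =
  Digamma x + 1/x.\<close>

lemma Digamma_ln_bounds:
  assumes "(x::real) > 0"
  shows "Digamma x \<le> ln x" "ln x \<le> Digamma x + 1 / x"
proof -
  have x: "x \<notin> \<int>\<^sub>\<le>\<^sub>0" using assms by (auto elim!: nonpos_Ints_cases)
  have "\<exists>\<xi>>x. \<xi> < x + 1 \<and> ln_Gamma (x + 1) - ln_Gamma x = (x + 1 - x) * Digamma \<xi>"
    using assms by (intro MVT2) (auto intro!: derivative_eq_intros)
  then obtain \<xi> where \<xi>: "x < \<xi>" "\<xi> < x + 1" "ln_Gamma (x + 1) - ln_Gamma x = Digamma \<xi>"
    by auto
  have "ln (Gamma (x + 1)) = ln x + ln (Gamma x)"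
    unfolding Gamma_plus1[OF x] using assms Gamma_real_pos[OF assms] by (rule ln_mult_pos)
  then have "ln_Gamma (x + 1) - ln_Gamma x = ln x"
    using assms by (simp add: ln_Gamma_real_pos)
  with \<xi> have "ln x = Digamma \<xi>" by simp
  moreover have "Digamma (x + 1) = Digamma x + 1 / x" using assms by (intro Digamma_plus1) auto
  ultimately show "Digamma x \<le> ln x" "ln x \<le> Digamma x + 1 / x"
    using \<xi> assms Digamma_real_mono[of x \<xi>] Digamma_real_mono[of \<xi> "x + 1"] by auto
qed

lemma digamma_rem_tendsto_0: "(digamma_rem \<longlongrightarrow> 0) at_top"
proof (rule tendsto_sandwich)
  show "\<forall>\<^sub>F x in at_top. - 1 / (2 * x) \<le> digamma_rem x"
    using eventually_gt_at_top[of 0]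
    by eventually_elim (use Digamma_ln_bounds in \<open>auto simp: digamma_rem_def\<close>)
  show "\<forall>\<^sub>F x in at_top. digamma_rem x \<le> 1 / (2 * x)"
    using eventually_gt_at_top[of 0]
  proof eventually_elim
    case (elim x)
    have "1 / x = 1 / (2 * x) + 1 / (2 * x)" using elim by (simp add: field_simps)
    then show ?case using Digamma_ln_bounds(2)[OF elim] by (simp add: digamma_rem_def)
  qed
qed real_asymp+

lemma has_real_derivative_digamma_rem:
  assumes "x > 0"
  shows "(digamma_rem has_real_derivative - (trigamma_rem x - 1 / (2 * x\<^sup>2))) (at x)"
proof -
  have "x \<notin> \<int>\<^sub>\<le>\<^sub>0" using assms by (auto elim!: nonpos_Ints_cases)
  then show ?thesis using assms unfolding digamma_rem_def[abs_def] trigamma_rem_def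
    by (auto intro!: derivative_eq_intros simp: power2_eq_square)
qed

text \<open>Obtained by integrating the trigamma representation over \<open>{x..}\<close> and exchanging the integrals.\<close>
lemma digamma_rem_nn_laplace:
  assumes x: "x > 0"
  shows "nn_laplace (\<lambda>s. s * f_aux s) x = ennreal (digamma_rem x)"
proof -
  have inner: "nn_laplace (\<lambda>s. s\<^sup>2 * f_aux s) y = ennreal (trigamma_rem y - 1 / (2 * y\<^sup>2))"
    if y: "y > 0" for y
  proof -
    have "nn_laplace (\<lambda>s. 1 / 2 * s + s\<^sup>2 * f_aux s) y = ennreal (trigamma_rem y)"
      using trigamma_rem_nn_laplace[OF y] by (simp add: algebra_simps power2_eq_square)
    moreover have "s\<^sup>2 * f_aux s \<ge> 0" if "s > 0" for s
      using mult_f_aux_bounds(1)[OF that] that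
      by (simp add: power2_eq_square zero_le_mult_iff)
    moreover have "nn_laplace (\<lambda>s. 1 / 2 * s) y = ennreal (1 / (2 * y\<^sup>2))"
      using nn_laplace_linear[OF y, of "1 / 2"] by simp
    ultimately have "ennreal (1 / (2 * y\<^sup>2)) + nn_laplace (\<lambda>s. s\<^sup>2 * f_aux s) y = ennreal (trigamma_rem y)"
      by (subst (asm) nn_laplace_add) auto
    then show ?thesis by (intro ennreal_plus_eqD) auto
  qed
  \<comment> \<open>Integrating out y costs a factor 1/s, which turns the density s^2 f(s) into s
    f(s).\<close>
  have outer: "(\<integral>\<^sup>+y\<in>{x..}. ennreal (s\<^sup>2 * f_aux s * exp (- y * s)) \<partial>lborel) =
      ennreal (s * f_aux s * exp (- x * s))" if s: "s > 0" for s
  proof -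
    have "(\<integral>\<^sup>+y\<in>{x..}. ennreal (s\<^sup>2 * f_aux s * exp (- y * s)) \<partial>lborel) =
        ennreal (0 - (- (s * f_aux s * exp (- x * s))))"
    proof (intro nn_integral_FTC_atLeast)
      show "((\<lambda>y. - (s * f_aux s * exp (- y * s))) has_real_derivative s\<^sup>2 * f_aux s * exp (- y * s)) (at y)" for y
        by (auto intro!: derivative_eq_intros simp: power2_eq_square)
      have "((\<lambda>y. exp (- y * s)) \<longlongrightarrow> 0) at_top" using s by real_asymp
      from tendsto_mult_left[OF this, of "- (s * f_aux s)"]
      show "((\<lambda>y. - (s * f_aux s * exp (- y * s))) \<longlongrightarrow> 0) at_top" by simp
    qed (use s mult_f_aux_bounds(1)[OF s] in \<open>auto simp: power2_eq_square zero_le_mult_iff\<close>)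
    then show ?thesis by simp
  qed
  have "nn_laplace (\<lambda>s. s * f_aux s) x =
      (\<integral>\<^sup>+s. (\<integral>\<^sup>+y. ennreal (s\<^sup>2 * f_aux s * exp (- y * s)) * indicator {x..} y * indicator {0<..} s \<partial>lborel) \<partial>lborel)"
    unfolding nn_laplace_def
  proof (intro nn_integral_cong)
    fix s :: real
    show "ennreal (s * f_aux s * exp (- x * s)) * indicator {0<..} s =
      (\<integral>\<^sup>+y. ennreal (s\<^sup>2 * f_aux s * exp (- y * s)) * indicator {x..} y * indicator {0<..} s \<partial>lborel)"
      using outer[of s] by (cases "s > 0") auto
  qed
  also have "\<dots> = (\<integral>\<^sup>+y. (\<integral>\<^sup>+s. ennreal (s\<^sup>2 * f_aux s * exp (- y * s)) * indicator {x..} y * indicator {0<..} s \<partial>lborel) \<partial>lborel)"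
    by (intro lborel_pair.Fubini') measurable
  also have "\<dots> = (\<integral>\<^sup>+y. nn_laplace (\<lambda>s. s\<^sup>2 * f_aux s) y * indicator {x..} y \<partial>lborel)"
    unfolding nn_laplace_def by (intro nn_integral_cong) (auto split: split_indicator)
  \<comment> \<open>The fundamental theorem wants a real integrand measurable on the whole line. A
    parametrised integral is measurable in its parameter, so \<open>enn2real\<close> of the
    transform provides one; on \<open>{x..}\<close> the transform is finite and nothing
    changes.\<close>
  also have "\<dots> = (\<integral>\<^sup>+y\<in>{x..}. ennreal (enn2real (nn_laplace (\<lambda>s. s\<^sup>2 * f_aux s) y)) \<partial>lborel)"
    using inner x by (intro nn_integral_cong) (auto split: split_indicator simp: ennreal_enn2real_if)
  also have "\<dots> = ennreal (0 - (- digamma_rem x))"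
  proof (intro nn_integral_FTC_atLeast)
    show "(\<lambda>y. enn2real (nn_laplace (\<lambda>s. s\<^sup>2 * f_aux s) y)) \<in> borel_measurable borel"
      unfolding nn_laplace_def by measurable
    show "((\<lambda>y. - digamma_rem y) has_real_derivative enn2real (nn_laplace (\<lambda>s. s\<^sup>2 * f_aux s) y)) (at y)"
      if "x \<le> y" for y
    proof -
      have y: "y > 0" using x that by simp
      have "enn2real (nn_laplace (\<lambda>s. s\<^sup>2 * f_aux s) y) = trigamma_rem y - 1 / (2 * y\<^sup>2)"
        using trigamma_rem_bounds(1)[OF y] by (simp add: inner[OF y])
      then show ?thesis using DERIV_minus[OF has_real_derivative_digamma_rem[OF y]] by simp
    qed
    show "((\<lambda>y. - digamma_rem y) \<longlongrightarrow> 0) at_top"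
      using tendsto_minus[OF digamma_rem_tendsto_0] by simp
  qed simp
  finally show ?thesis by simp
qed

text \<open>The \<open>ennreal\<close> identity leaves the sign open, so nonnegativity comes from
  monotonicity: by the lower trigamma bound the derivative is at most 0, and the limit at infinity
  is 0. The upper bound integrates s f(s) \<le> s/4.\<close>

lemma digamma_rem_bounds:
  assumes x: "x > 0"
  shows "0 \<le> digamma_rem x" "digamma_rem x \<le> 1 / x\<^sup>2"
proof -
  show "0 \<le> digamma_rem x"
  proof (rule tendsto_upperbound[OF digamma_rem_tendsto_0])
    show "\<forall>\<^sub>F y in at_top. digamma_rem y \<le> digamma_rem x"
      using eventually_ge_at_top[of x]
    proof eventually_elim
      case (elim y)
      show ?case
      proof (rule DERIV_nonpos_imp_nonincreasing[OF elim])
        fix z assume "x \<le> z"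
        then have z: "z > 0" using x by simp
        show "\<exists>D. (digamma_rem has_real_derivative D) (at z) \<and> D \<le> 0"
          using has_real_derivative_digamma_rem[OF z] trigamma_rem_bounds(1)[OF z] by force
      qed
    qed
  qed simp
  have "ennreal (digamma_rem x) = nn_laplace (\<lambda>s. s * f_aux s) x"
    by (rule digamma_rem_nn_laplace[OF x, symmetric])
  also have "\<dots> \<le> nn_laplace (\<lambda>s. 1 / 4 * s) x"
    using mult_f_aux_bounds(3) by (intro nn_laplace_mono) auto
  also have "\<dots> = ennreal (1 / (4 * x\<^sup>2))"
    using nn_laplace_linear[OF x, of "1 / 4"] by simp
  finally have "digamma_rem x \<le> 1 / (4 * x\<^sup>2)" by (subst (asm) ennreal_le_iff) auto
  \<comment> \<open>The constant is given away so that both remainders meet the same hypothesis of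
    \<open>laplace_lattice_sums\<close>.\<close>
  also have "\<dots> \<le> 1 / x\<^sup>2" using x by (simp add: field_simps)
  finally show "digamma_rem x \<le> 1 / x\<^sup>2" .
qed

text \<open>Summing exp (-b j s) over j \<ge> 1 gives 1/(exp (b s) - 1), and nonnegativity permits
  the exchange with the integral. The bound 1/x^2 makes the sum finite.\<close>

lemma laplace_lattice_sums:
  assumes g [measurable]: "g \<in> borel_measurable borel" and nonneg: "\<And>s. s > 0 \<Longrightarrow> g s \<ge> 0"
    and h: "\<And>x. x > 0 \<Longrightarrow> nn_laplace g x = ennreal (h x)"
    and h_bounds: "\<And>x. x > 0 \<Longrightarrow> 0 \<le> h x" "\<And>x. x > 0 \<Longrightarrow> h x \<le> 1 / x\<^sup>2"
    and b: "b > 0"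
  shows "(\<lambda>j. h (b * real (Suc j))) sums integral {0<..} (\<lambda>s. g s / (exp (b * s) - 1))"
proof -
  have summ: "summable (\<lambda>j. h (b * real (Suc j)))"
  proof (rule summable_comparison_test')
    have "summable (\<lambda>n. inverse (real n ^ 2))" by (intro inverse_power_summable) simp
    then have "summable (\<lambda>n. inverse (real (Suc n) ^ 2))" by (subst summable_Suc_iff)
    then show "summable (\<lambda>j. 1 / b\<^sup>2 * inverse (real (Suc j) ^ 2))" by (intro summable_mult)
    fix j :: nat
    have "b * real (Suc j) > 0" using b by simp
    from h_bounds[OF this] show "norm (h (b * real (Suc j))) \<le> 1 / b\<^sup>2 * inverse (real (Suc j) ^ 2)"
      by (simp add: power_mult_distrib field_simps del: of_nat_Suc)
  qed
  define S where "S = (\<Sum>j. h (b * real (Suc j)))"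
  have S: "S \<ge> 0" unfolding S_def using b h_bounds(1) summ by (intro suminf_nonneg) auto
  define G where "G s = g s / (exp (b * s) - 1) * indicator {0<..} s" for s
  have "(\<integral>\<^sup>+s. ennreal (G s) \<partial>lborel) =
      (\<integral>\<^sup>+s. (\<Sum>j. ennreal (g s * exp (- (b * real (Suc j)) * s)) * indicator {0<..} s) \<partial>lborel)"
  proof (intro nn_integral_cong)
    fix s :: real
    show "ennreal (G s) = (\<Sum>j. ennreal (g s * exp (- (b * real (Suc j)) * s)) * indicator {0<..} s)"
    proof (cases "s > 0")
      case True
      \<comment> \<open>The lattice starts at b, not at 0, so the geometric series starts with q
        itself; this is what yields exp (b s) - 1 in the denominator.\<close>
      define q where "q = exp (- b * s)"
      have q: "0 < q" "q < 1" using True b by (auto simp: q_def)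
      have "(\<lambda>k. q ^ k) sums (1 / (1 - q))" using q by (intro geometric_sums) simp
      from sums_mult[OF this, of "g s * q"]
      have "(\<lambda>k. g s * q * q ^ k) sums (g s * q * (1 / (1 - q)))" .
      also have "g s * q * (1 / (1 - q)) = g s / (exp (b * s) - 1)"
        using q by (simp add: q_def exp_minus field_simps)
      also have "(\<lambda>k. g s * q * q ^ k) = (\<lambda>k. g s * exp (- (b * real (Suc k)) * s))"
        by (intro ext) (simp add: q_def exp_of_nat_mult[symmetric] exp_add[symmetric] algebra_simps)
      finally have "(\<Sum>k. ennreal (g s * exp (- (b * real (Suc k)) * s))) = ennreal (g s / (exp (b * s) - 1))"
        using nonneg[OF True] by (intro suminf_ennreal_eq) auto
      then show ?thesis using True by (simp add: G_def)
    qed (auto simp: G_def)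
  qed
  also have "\<dots> = (\<Sum>j. nn_laplace g (b * real (Suc j)))"
    unfolding nn_laplace_def by (subst nn_integral_suminf) auto
  also have "\<dots> = (\<Sum>j. ennreal (h (b * real (Suc j))))"
    using b by (intro suminf_cong h) auto
  also have "\<dots> = ennreal S"
    using b h_bounds(1) summ unfolding S_def by (intro suminf_ennreal_eq) auto
  \<comment> \<open>A finite integral of a nonnegative function passes from the Lebesgue sense to
    the gauge integral in which \<open>K1\<close> and \<open>K2\<close> are stated.\<close>
  finally have "(G has_integral S) UNIV"
    using S b nonneg unfolding G_def
    by (intro nn_integral_has_integral) (auto split: split_indicator)
  moreover have "G = (\<lambda>s. if s \<in> {0<..} then g s / (exp (b * s) - 1) else 0)"
    by (auto simp: G_def fun_eq_iff)
  ultimately have "((\<lambda>s. g s / (exp (b * s) - 1)) has_integral S) {0<..}"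
    by (simp only: has_integral_restrict_UNIV)
  then show ?thesis using summ unfolding S_def
    by (simp add: integral_unique summable_sums)
qed

section \<open>Logarithmic moments of the Beta distribution\<close>

text \<open>Unnormalised Beta(a, c) density times a power of the logarithm. Differentiation in a
  multiplies by ln x, that is, raises k by one, so the logarithmic moments are derivatives of the
  Beta function.\<close>

definition beta_log_kernel :: "real \<Rightarrow> nat \<Rightarrow> real \<Rightarrow> real \<Rightarrow> real" where
  "beta_log_kernel c k a x = indicator {0<..<1} x * (x powr (a - 1) * (1 - x) powr (c - 1) * ln x ^ k)"

lemma borel_measurable_beta_log_kernel [measurable]: "beta_log_kernel c k a \<in> borel_measurable borel"
  unfolding beta_log_kernel_def[abs_def] by measurable

lemma abs_ln_le_powr:
  assumes "0 < x" "x < 1" "e > (0::real)"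
  shows "\<bar>ln x\<bar> \<le> x powr (- e) / e"
proof -
  have "ln (x powr (- e)) \<le> x powr (- e) - 1" using assms by (intro ln_le_minus_one) simp
  then have "- e * ln x \<le> x powr (- e)" using assms by (simp add: ln_powr)
  then show ?thesis using assms by (simp add: field_simps)
qed

text \<open>One logarithm is paid for with half of the exponent: |ln x| \<le> x powr (-e) / e with e
  = a/2.\<close>

lemma abs_beta_log_kernel_Suc_le:
  assumes "a > 0"
  shows "\<bar>beta_log_kernel c (Suc k) a x\<bar> \<le> 2 / a * \<bar>beta_log_kernel c k (a / 2) x\<bar>"
proof (cases "0 < x \<and> x < 1")
  case True
  then have "\<bar>ln x\<bar> * x powr (a - 1) \<le> x powr (- (a / 2)) / (a / 2) * x powr (a - 1)"
    using assms by (intro mult_right_mono abs_ln_le_powr) auto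
  also have "\<dots> = 2 / a * (x powr (- (a / 2)) * x powr (a - 1))" by simp
  also have "x powr (- (a / 2)) * x powr (a - 1) = x powr (a / 2 - 1)"
    by (subst powr_add[symmetric]) (simp add: field_simps)
  finally have "\<bar>ln x\<bar> * x powr (a - 1) \<le> 2 / a * x powr (a / 2 - 1)" .
  from mult_right_mono[OF this, of "(1 - x) powr (c - 1) * \<bar>ln x\<bar> ^ k"] True show ?thesis
    by (simp add: beta_log_kernel_def abs_mult power_abs mult_ac)
qed (auto simp: beta_log_kernel_def)

text \<open>Each logarithm halves a, so the induction on k must leave a arbitrary; for k = 0 the
  integrand is that of the Beta function.\<close>

lemma integrable_beta_log_kernel:
  assumes "a > 0" "c > 0"
  shows "integrable lborel (beta_log_kernel c k a)"
  using assms(1)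
proof (induction k arbitrary: a)
  case 0
  have "integrable lborel (\<lambda>x. indicator {0..1} x *\<^sub>R (x powr (a - 1) * (1 - x) powr (c - 1)))"
    using integrable_Beta[OF 0 assms(2)] by (simp add: set_integrable_def)
  then show ?case
    by (rule Bochner_Integration.integrable_bound)
       (auto simp: beta_log_kernel_def split: split_indicator)
next
  case (Suc k)
  have "integrable lborel (\<lambda>x. 2 / a * beta_log_kernel c k (a / 2) x)"
    using Suc by (intro integrable_mult_right) auto
  then show ?case
  proof (rule Bochner_Integration.integrable_bound)
    show "AE x in lborel. norm (beta_log_kernel c (Suc k) a x) \<le> norm (2 / a * beta_log_kernel c k (a / 2) x)"
      using abs_beta_log_kernel_Suc_le[OF Suc.prems] Suc.prems by (auto simp: abs_mult)
  qed simp
qed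

text \<open>Mean value estimate in the exponent. If |h| \<le> a/2, all exponents between stay above
  a/2 - 1, and x powr t decreases in t for x < 1; the bound is therefore independent of h and can
  dominate the difference quotients.\<close>

lemma beta_log_kernel_diff_bound:
  assumes "a > 0" "h \<noteq> 0" "\<bar>h\<bar> \<le> a / 2"
  shows "\<bar>(beta_log_kernel c k (a + h) x - beta_log_kernel c k a x) / h\<bar>
    \<le> \<bar>beta_log_kernel c (Suc k) (a / 2) x\<bar>"
proof (cases "0 < x \<and> x < 1")
  case True
  have deriv: "((\<lambda>t. x powr t) has_real_derivative ln x * x powr t) (at t)" for t
    using True by (auto intro!: derivative_eq_intros)
  have bound: "\<bar>ln x * x powr t\<bar> \<le> \<bar>ln x\<bar> * x powr (a / 2 - 1)" if "t \<ge> a / 2 - 1" for t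
    using True that powr_mono'[of "a / 2 - 1" t x] by (auto simp: abs_mult intro!: mult_left_mono)
  have "\<bar>x powr (a + h - 1) - x powr (a - 1)\<bar> \<le> \<bar>ln x\<bar> * x powr (a / 2 - 1) * \<bar>(a + h - 1) - (a - 1)\<bar>"
    unfolding real_norm_def[symmetric]
    by (rule field_differentiable_bound[of "{a / 2 - 1..}"])
       (use assms deriv bound in \<open>auto intro: has_field_derivative_at_within\<close>)
  then have "\<bar>(x powr (a + h - 1) - x powr (a - 1)) / h\<bar> \<le> \<bar>ln x\<bar> * x powr (a / 2 - 1)"
    using assms by (simp add: divide_le_eq)
  from mult_right_mono[OF this, of "(1 - x) powr (c - 1) * \<bar>ln x\<bar> ^ k"] True
  have "\<bar>(x powr (a + h - 1) - x powr (a - 1)) / h * ((1 - x) powr (c - 1) * ln x ^ k)\<bar>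
      \<le> \<bar>ln x\<bar> * x powr (a / 2 - 1) * ((1 - x) powr (c - 1) * \<bar>ln x\<bar> ^ k)"
    by (simp add: abs_mult power_abs)
  moreover have "(beta_log_kernel c k (a + h) x - beta_log_kernel c k a x) / h =
      (x powr (a + h - 1) - x powr (a - 1)) / h * ((1 - x) powr (c - 1) * ln x ^ k)"
    using True by (simp add: beta_log_kernel_def algebra_simps diff_divide_distrib)
  ultimately have "\<bar>(beta_log_kernel c k (a + h) x - beta_log_kernel c k a x) / h\<bar>
      \<le> \<bar>ln x\<bar> * x powr (a / 2 - 1) * ((1 - x) powr (c - 1) * \<bar>ln x\<bar> ^ k)"
    by (simp only:)
  also have "\<dots> = \<bar>beta_log_kernel c (Suc k) (a / 2) x\<bar>"
    using True by (simp add: beta_log_kernel_def abs_mult power_abs mult_ac)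
  finally show ?thesis .
qed (auto simp: beta_log_kernel_def)

lemma beta_log_kernel_has_derivative:
  "((\<lambda>a. beta_log_kernel c k a x) has_real_derivative beta_log_kernel c (Suc k) a x) (at a)"
  unfolding beta_log_kernel_def
  by (cases "x > 0") (auto intro!: derivative_eq_intros split: split_indicator)

text \<open>Differentiation under the integral sign, by dominated convergence along an arbitrary
  sequence tending to a.\<close>

lemma has_real_derivative_beta_log_integral:
  assumes a: "a > 0" and c: "c > 0"
  shows "((\<lambda>a. \<integral>x. beta_log_kernel c k a x \<partial>lborel) has_real_derivative
           (\<integral>x. beta_log_kernel c (Suc k) a x \<partial>lborel)) (at a)"
  unfolding has_field_derivative_iff tendsto_at_iff_sequentially o_def
proof (intro allI impI)
  fix y assume y: "\<forall>i. y i \<in> UNIV - {a}" "y \<longlonglongrightarrow> a"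
  define h where "h i = y i - a" for i
  have h: "h i \<noteq> 0" "y i = a + h i" for i using y by (auto simp: h_def)
  have h0: "h \<longlonglongrightarrow> 0" using tendsto_diff[OF y(2) tendsto_const[of a]] by (simp add: h_def[abs_def])
  \<comment> \<open>The dominating function serves increments of size at most a/2 only, so the first
    N terms are dropped and restored at the end.\<close>
  obtain N where N: "\<And>i. i \<ge> N \<Longrightarrow> \<bar>h i\<bar> \<le> a / 2"
    using LIMSEQ_D[OF h0, of "a / 2"] a by (fastforce simp: less_imp_le)
  have "(\<lambda>i. \<integral>x. (beta_log_kernel c k (y (i + N)) x - beta_log_kernel c k a x) / h (i + N) \<partial>lborel)
      \<longlonglongrightarrow> (\<integral>x. beta_log_kernel c (Suc k) a x \<partial>lborel)"
  proof (rule integral_dominated_convergence)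
    show "integrable lborel (\<lambda>x. \<bar>beta_log_kernel c (Suc k) (a / 2) x\<bar>)"
      using integrable_beta_log_kernel[of "a / 2" c "Suc k"] a c by simp
    show "AE x in lborel. norm ((beta_log_kernel c k (y (i + N)) x - beta_log_kernel c k a x) / h (i + N))
        \<le> \<bar>beta_log_kernel c (Suc k) (a / 2) x\<bar>" for i
      using beta_log_kernel_diff_bound[OF a h(1) N] h(2) by simp
    show "AE x in lborel. (\<lambda>i. (beta_log_kernel c k (y (i + N)) x - beta_log_kernel c k a x) / h (i + N))
        \<longlonglongrightarrow> beta_log_kernel c (Suc k) a x"
    proof (rule AE_I2)
      fix x
      have "(\<lambda>i. (beta_log_kernel c k (y i) x - beta_log_kernel c k a x) / (y i - a))
          \<longlonglongrightarrow> beta_log_kernel c (Suc k) a x"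
        using beta_log_kernel_has_derivative[of c k x a] y
        unfolding has_field_derivative_iff tendsto_at_iff_sequentially o_def by blast
      then show "(\<lambda>i. (beta_log_kernel c k (y (i + N)) x - beta_log_kernel c k a x) / h (i + N))
          \<longlonglongrightarrow> beta_log_kernel c (Suc k) a x"
        unfolding h_def by (rule LIMSEQ_ignore_initial_segment)
    qed
  qed auto
  then have "(\<lambda>i. ((\<integral>x. beta_log_kernel c k (y (i + N)) x \<partial>lborel) - (\<integral>x. beta_log_kernel c k a x \<partial>lborel))
        / (y (i + N) - a)) \<longlonglongrightarrow> (\<integral>x. beta_log_kernel c (Suc k) a x \<partial>lborel)"
  proof (rule back_subst[of "\<lambda>f. f \<longlonglongrightarrow> _"])
    show "(\<lambda>i. \<integral>x. (beta_log_kernel c k (y (i + N)) x - beta_log_kernel c k a x) / h (i + N) \<partial>lborel) =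
      (\<lambda>i. ((\<integral>x. beta_log_kernel c k (y (i + N)) x \<partial>lborel) - (\<integral>x. beta_log_kernel c k a x \<partial>lborel))
        / (y (i + N) - a))"
    proof
      fix i
      have "\<bar>h (i + N)\<bar> \<le> a / 2" by (intro N) simp
      then have "y (i + N) > 0" using a unfolding h_def by linarith
      then have "integrable lborel (beta_log_kernel c k (y (i + N)))" "integrable lborel (beta_log_kernel c k a)"
        using a c by (intro integrable_beta_log_kernel; simp)+
      then show "(\<integral>x. (beta_log_kernel c k (y (i + N)) x - beta_log_kernel c k a x) / h (i + N) \<partial>lborel) =
        ((\<integral>x. beta_log_kernel c k (y (i + N)) x \<partial>lborel) - (\<integral>x. beta_log_kernel c k a x \<partial>lborel))
        / (y (i + N) - a)"
        by (simp add: h_def)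
    qed
  qed
  then show "(\<lambda>i. ((\<integral>x. beta_log_kernel c k (y i) x \<partial>lborel) - (\<integral>x. beta_log_kernel c k a x \<partial>lborel))
        / (y i - a)) \<longlonglongrightarrow> (\<integral>x. beta_log_kernel c (Suc k) a x \<partial>lborel)"
    by (rule LIMSEQ_offset)
qed

lemma beta_log_integral_0:
  assumes "a > 0" "c > 0"
  shows "(\<integral>x. beta_log_kernel c 0 a x \<partial>lborel) = Beta a c"
proof -
  have "(beta_log_kernel c 0 a has_integral (\<integral>x. beta_log_kernel c 0 a x \<partial>lborel)) UNIV"
    by (rule has_integral_integral_lborel[OF integrable_beta_log_kernel[OF assms]])
  moreover have "beta_log_kernel c 0 a =
      (\<lambda>x. if x \<in> {0<..<1} then x powr (a - 1) * (1 - x) powr (c - 1) else 0)"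
    by (auto simp: beta_log_kernel_def fun_eq_iff)
  ultimately have "((\<lambda>x. x powr (a - 1) * (1 - x) powr (c - 1)) has_integral
      (\<integral>x. beta_log_kernel c 0 a x \<partial>lborel)) {0<..<1}"
    by (simp only: has_integral_restrict_UNIV)
  then show ?thesis
    using has_integral_Beta_real[OF assms] has_integral_unique
    by (auto simp: has_integral_Icc_iff_Ioo)
qed

text \<open>The integral for k = 0 is \<open>Beta a c\<close> for all a > 0, so the derivative taken
  under the integral must agree with the known derivative of the Beta function.\<close>

lemma beta_log_integral_1:
  assumes "a > 0" "c > 0"
  shows "(\<integral>x. beta_log_kernel c 1 a x \<partial>lborel) = Beta a c * (Digamma a - Digamma (a + c))"
proof (rule DERIV_unique)
  show "((\<lambda>a. \<integral>x. beta_log_kernel c 0 a x \<partial>lborel) has_real_derivative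
      (\<integral>x. beta_log_kernel c 1 a x \<partial>lborel)) (at a)"
    using has_real_derivative_beta_log_integral[OF assms, of 0] by simp
  have "((\<lambda>a. Beta a c) has_real_derivative Beta a c * (Digamma a - Digamma (a + c))) (at a)"
    using assms by (intro has_field_derivative_Beta1) (auto elim!: nonpos_Ints_cases)
  then show "((\<lambda>a. \<integral>x. beta_log_kernel c 0 a x \<partial>lborel) has_real_derivative
      Beta a c * (Digamma a - Digamma (a + c))) (at a)"
    by (rule has_field_derivative_transform_within_open[of _ _ _ "{0<..}"])
       (use assms beta_log_integral_0 in auto)
qed

text \<open>The same comparison one derivative later; the squared digamma difference comes from
  differentiating the Beta factor and is the squared mean that the variance subtracts.\<close>

lemma beta_log_integral_2:
  assumes "a > 0" "c > 0"
  shows "(\<integral>x. beta_log_kernel c 2 a x \<partial>lborel) =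
    Beta a c * ((Digamma a - Digamma (a + c))\<^sup>2 + Polygamma 1 a - Polygamma 1 (a + c))"
proof (rule DERIV_unique)
  show "((\<lambda>a. \<integral>x. beta_log_kernel c 1 a x \<partial>lborel) has_real_derivative
      (\<integral>x. beta_log_kernel c 2 a x \<partial>lborel)) (at a)"
    using has_real_derivative_beta_log_integral[OF assms, of 1] by (simp add: numeral_2_eq_2)
  have ac: "a \<notin> \<int>\<^sub>\<le>\<^sub>0" "a + c \<notin> \<int>\<^sub>\<le>\<^sub>0" using assms by (auto elim!: nonpos_Ints_cases)
  have "((\<lambda>a. Beta a c * (Digamma a - Digamma (a + c))) has_real_derivative
      Beta a c * ((Digamma a - Digamma (a + c))\<^sup>2 + Polygamma 1 a - Polygamma 1 (a + c))) (at a)"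
    using ac by (auto intro!: derivative_eq_intros simp: power2_eq_square algebra_simps)
  then show "((\<lambda>a. \<integral>x. beta_log_kernel c 1 a x \<partial>lborel) has_real_derivative
      Beta a c * ((Digamma a - Digamma (a + c))\<^sup>2 + Polygamma 1 a - Polygamma 1 (a + c))) (at a)"
    by (rule has_field_derivative_transform_within_open[of _ _ _ "{0<..}"])
       (use assms beta_log_integral_1 in auto)
qed

lemma beta_density_eq_kernel:
  "beta_density a c x * ln x ^ k = beta_log_kernel c k a x / Beta a c"
  by (simp add: beta_density_def beta_log_kernel_def)

lemma Beta_real_pos: "a > 0 \<Longrightarrow> c > 0 \<Longrightarrow> Beta a c > (0::real)"
  by (simp add: Beta_def Gamma_real_pos)

lemma beta_density_nonneg: "a > 0 \<Longrightarrow> c > 0 \<Longrightarrow> beta_density a c x \<ge> 0"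
  using Beta_real_pos[of a c] by (simp add: beta_density_def)

section \<open>Mean and variance of the logarithm of a Beta variable\<close>

context
  fixes M :: "'a measure" and X :: "'a \<Rightarrow> real" and a c :: real
  assumes ac: "a > 0" "c > 0"
    and distr: "distributed M lborel X (\<lambda>x. ennreal (beta_density a c x))"
begin

lemma beta_distributed_ln_power:
  "integrable M (\<lambda>\<omega>. ln (X \<omega>) ^ k)"
  "(\<integral>\<omega>. ln (X \<omega>) ^ k \<partial>M) = (\<integral>x. beta_log_kernel c k a x \<partial>lborel) / Beta a c"
proof -
  have "integrable lborel (\<lambda>x. beta_density a c x * ln x ^ k)"
    unfolding beta_density_eq_kernel using integrable_beta_log_kernel[OF ac] by simp
  then show "integrable M (\<lambda>\<omega>. ln (X \<omega>) ^ k)"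
    using distributed_integrable[OF distr, of "\<lambda>x. ln x ^ k"] beta_density_nonneg[OF ac] by simp
  have "(\<integral>x. beta_density a c x * ln x ^ k \<partial>lborel) = (\<integral>\<omega>. ln (X \<omega>) ^ k \<partial>M)"
    using distributed_integral[OF distr, of "\<lambda>x. ln x ^ k"] beta_density_nonneg[OF ac] by simp
  then show "(\<integral>\<omega>. ln (X \<omega>) ^ k \<partial>M) = (\<integral>x. beta_log_kernel c k a x \<partial>lborel) / Beta a c"
    unfolding beta_density_eq_kernel by simp
qed

lemma beta_distributed_expectation_ln:
  "(\<integral>\<omega>. ln (X \<omega>) \<partial>M) = Digamma a - Digamma (a + c)"
  using beta_distributed_ln_power(2)[of 1] beta_log_integral_1[OF ac] Beta_real_pos[OF ac] by simp

lemma beta_distributed_variance_ln: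
  assumes "prob_space M"
  shows "prob_space.variance M (\<lambda>\<omega>. ln (X \<omega>)) = Polygamma 1 a - Polygamma 1 (a + c)"
proof -
  interpret prob_space M by fact
  have "variance (\<lambda>\<omega>. ln (X \<omega>)) = (\<integral>\<omega>. ln (X \<omega>) ^ 2 \<partial>M) - (\<integral>\<omega>. ln (X \<omega>) \<partial>M)\<^sup>2"
    using beta_distributed_ln_power(1)[of 1] beta_distributed_ln_power(1)[of 2]
    by (intro variance_eq) auto
  then show ?thesis
    using beta_distributed_ln_power(2)[of 2] beta_log_integral_2[OF ac] Beta_real_pos[OF ac]
    by (simp add: beta_distributed_expectation_ln)
qed

end

text \<open>For the centred variables the cross terms of the squared sum vanish by independence. The
  square integrability of the sum is recorded because Chebyshev's inequality asks for it.\<close>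

lemma (in prob_space) variance_sum_indep:
  fixes X :: "'i \<Rightarrow> 'a \<Rightarrow> real"
  assumes "finite I" and indep: "indep_vars (\<lambda>_. borel) X I"
    and int: "\<And>i. i \<in> I \<Longrightarrow> integrable M (X i)" "\<And>i. i \<in> I \<Longrightarrow> integrable M (\<lambda>x. X i x ^ 2)"
  shows "integrable M (\<lambda>x. (\<Sum>i\<in>I. X i x)\<^sup>2)" "variance (\<lambda>x. \<Sum>i\<in>I. X i x) = (\<Sum>i\<in>I. variance (X i))"
proof -
  define Y where "Y i x = X i x - expectation (X i)" for i x
  have Y_int: "integrable M (Y i)" "expectation (Y i) = 0" if "i \<in> I" for i
    using int(1)[OF that] by (simp_all add: Y_def[abs_def] prob_space)
  have Y_indep: "indep_vars (\<lambda>_. borel) Y I"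
    unfolding Y_def by (rule indep_vars_compose2[OF indep]) measurable
  have prod: "integrable M (\<lambda>x. Y i x * Y j x)"
    "expectation (\<lambda>x. Y i x * Y j x) = (if i = j then variance (X i) else 0)"
    if "i \<in> I" "j \<in> I" for i j
  proof -
    have "integrable M (\<lambda>x. Y i x * Y j x) \<and>
      expectation (\<lambda>x. Y i x * Y j x) = (if i = j then variance (X i) else 0)"
    proof (cases "i = j")
      case True
      have "integrable M (\<lambda>x. (X i x)\<^sup>2 - 2 * X i x * expectation (X i) + (expectation (X i))\<^sup>2)"
        using int[OF that(1)] by auto
      then show ?thesis using True by (simp add: Y_def power2_eq_square algebra_simps)
    next
      case False
      have "indep_vars (\<lambda>_. borel) Y {i, j}"
        using that by (intro indep_vars_subset[OF Y_indep]) auto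
      from indep_vars_integrable[OF _ this] indep_vars_lebesgue_integral[OF _ this] show ?thesis
        using False Y_int that by auto
    qed
    then show "integrable M (\<lambda>x. Y i x * Y j x)"
      "expectation (\<lambda>x. Y i x * Y j x) = (if i = j then variance (X i) else 0)" by auto
  qed
  have exp_sum: "expectation (\<lambda>x. \<Sum>i\<in>I. X i x) = (\<Sum>i\<in>I. expectation (X i))"
    using int(1) by simp
  have "(\<Sum>i\<in>I. X i x) - (\<Sum>i\<in>I. expectation (X i)) = (\<Sum>i\<in>I. Y i x)" for x
    by (simp add: Y_def sum_subtractf)
  then have "variance (\<lambda>x. \<Sum>i\<in>I. X i x) = expectation (\<lambda>x. \<Sum>i\<in>I. \<Sum>j\<in>I. Y i x * Y j x)"
    unfolding exp_sum by (simp add: power2_eq_square sum_product)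
  also have "\<dots> = (\<Sum>i\<in>I. \<Sum>j\<in>I. expectation (\<lambda>x. Y i x * Y j x))"
    using prod(1) by simp
  also have "\<dots> = (\<Sum>i\<in>I. variance (X i))"
    using prod(2) \<open>finite I\<close> by (intro sum.cong refl) (simp add: sum.delta)
  finally show "variance (\<lambda>x. \<Sum>i\<in>I. X i x) = (\<Sum>i\<in>I. variance (X i))" .
  \<comment> \<open>The square of the sum is the double sum of centred products, already known to be
    integrable, plus a linear term and a constant.\<close>
  have eq: "(\<Sum>i\<in>I. X i x)\<^sup>2 = (\<Sum>i\<in>I. \<Sum>j\<in>I. Y i x * Y j x)
      + 2 * (\<Sum>i\<in>I. expectation (X i)) * (\<Sum>i\<in>I. X i x) - (\<Sum>i\<in>I. expectation (X i))\<^sup>2" for x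
  proof -
    have "(\<Sum>i\<in>I. \<Sum>j\<in>I. Y i x * Y j x) = ((\<Sum>i\<in>I. X i x) - (\<Sum>i\<in>I. expectation (X i)))\<^sup>2"
      unfolding sum_product[symmetric] by (simp add: Y_def sum_subtractf power2_eq_square)
    then show ?thesis by (simp add: power2_diff)
  qed
  show "integrable M (\<lambda>x. (\<Sum>i\<in>I. X i x)\<^sup>2)"
    unfolding eq using prod(1) int(1) by auto
qed

section \<open>Asymptotics of the mean and the variance\<close>

text \<open>Since \<open>ln 0 = 0\<close>, \<open>ln_fact_rem 0 = 0\<close>, so the exact formulas below cover the edge \<open>p = n\<close>.\<close>
definition ln_fact_rem :: "nat \<Rightarrow> real" where
  "ln_fact_rem k = ln (fact k) - (real k * ln (real k) - real k)"

definition digamma_rem_sum :: "real \<Rightarrow> nat \<Rightarrow> real" where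
  "digamma_rem_sum b n = (\<Sum>j<n. digamma_rem (b * real (Suc j)))"

definition trigamma_rem_sum :: "real \<Rightarrow> nat \<Rightarrow> real" where
  "trigamma_rem_sum b n = (\<Sum>j<n. trigamma_rem (b * real (Suc j)))"

text \<open>The summand k = 1 vanishes, since n - k + 1 = n there; this matches the deterministic
  first factor 1.\<close>

definition mean_logdet :: "real \<Rightarrow> nat \<Rightarrow> nat \<Rightarrow> real" where
  "mean_logdet b n p = (\<Sum>k=1..p. Digamma (b * real (n - k + 1)) - Digamma (b * real n))"

definition var_logdet :: "real \<Rightarrow> nat \<Rightarrow> nat \<Rightarrow> real" where
  "var_logdet b n p = (\<Sum>k=1..p. Polygamma 1 (b * real (n - k + 1)) - Polygamma 1 (b * real n))"

lemma ln_fact_rem_LIMSEQ: "(\<lambda>n. ln_fact_rem n - 1 / 2 * ln (real n)) \<longlonglongrightarrow> ln (2 * pi) / 2"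
  using ln_fact_stirling unfolding ln_fact_rem_def by (simp add: algebra_simps)

lemma digamma_rem_sum_LIMSEQ:
  assumes "b > 0"
  shows "digamma_rem_sum b \<longlonglongrightarrow> integral {0<..} (\<lambda>s. s * f_aux s / (exp (b * s) - 1))"
  unfolding digamma_rem_sum_def[abs_def] sums_def[symmetric]
  by (rule laplace_lattice_sums)
    (use assms digamma_rem_nn_laplace digamma_rem_bounds mult_f_aux_bounds(1) in auto)

lemma trigamma_rem_sum_LIMSEQ:
  assumes "b > 0"
  shows "trigamma_rem_sum b \<longlonglongrightarrow> integral {0<..} (\<lambda>s. s * (s * f_aux s + 1 / 2) / (exp (b * s) - 1))"
  unfolding trigamma_rem_sum_def[abs_def] sums_def[symmetric]
  by (rule laplace_lattice_sums)
    (use assms trigamma_rem_nn_laplace trigamma_rem_nonneg trigamma_rem_bounds(2) mult_f_aux_bounds(1) in auto)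

text \<open>With m = n - p this shows the rate function to be the leading Stirling terms of ln m!
  and ln n! together with the p-fold ln n from the subtracted digamma values. Adding it to the mean
  leaves only \<open>ln_fact_rem\<close>. The case m = 0 rests on the value
  \<open>J_rate 0 = 1\<close>.\<close>

lemma mult_J_rate_eq:
  assumes "m \<le> n" "n > 0"
  shows "real n * J_rate (1 - real (n - m) / real n) =
    (real m * ln (real m) - real m) - (real n * ln (real n) - real n) + real (n - m) * ln (real n)"
proof (cases "m = 0")
  case False
  have "1 - real (n - m) / real n = real m / real n"
    using assms by (simp add: of_nat_diff field_simps)
  then show ?thesis using assms False
    by (simp add: J_rate_def ln_div of_nat_diff) (simp add: field_simps)
qed (use assms in \<open>simp add: J_rate_def\<close>)

text \<open>The logarithms of the digamma values telescope to a quotient of factorials, and their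
  1/(2x) terms to harmonic numbers. Induction on p adds the lattice point b (n - p).\<close>

lemma mean_logdet_eq:
  assumes b: "b > 0" and n: "n > 0" and p: "p \<le> n"
  shows "mean_logdet b n p = ln (fact n) - ln (fact (n - p)) - (harm n - harm (n - p)) / (2 * b)
    - (digamma_rem_sum b n - digamma_rem_sum b (n - p)) - real p * ln (real n)
    + real p / (2 * b * real n) + real p * digamma_rem (b * real n)"
  using p
proof (induction p)
  case 0
  then show ?case by (simp add: mean_logdet_def)
next
  case (Suc p)
  then obtain m where m: "n - p = Suc m" "n - Suc p = m"
    by (metis Suc_diff_Suc Suc_le_eq)
  have "mean_logdet b n (Suc p) = mean_logdet b n p + (Digamma (b * real (Suc m)) - Digamma (b * real n))"
    using m by (simp add: mean_logdet_def del: of_nat_Suc)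
  \<comment> \<open>The ln b appearing here and in the expansion at b n cancel, so the mean depends
    on b only through the lower-order terms.\<close>
  moreover have "Digamma (b * real (Suc m)) =
      ln b + ln (real (Suc m)) - 1 / (2 * b * real (Suc m)) - digamma_rem (b * real (Suc m))"
    using b by (simp add: digamma_rem_def ln_mult del: of_nat_Suc)
  moreover have "Digamma (b * real n) =
      ln b + ln (real n) - 1 / (2 * b * real n) - digamma_rem (b * real n)"
    using b n by (simp add: digamma_rem_def ln_mult)
  moreover have "ln (fact (Suc m)) = ln (real (Suc m)) + ln (fact m :: real)"
    by (simp add: ln_mult del: of_nat_Suc)
  moreover have "harm (Suc m) / (2 * b) = harm m / (2 * b) + 1 / (2 * b * real (Suc m))"
    using b by (simp add: harm_Suc field_simps del: of_nat_Suc)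
  moreover have "digamma_rem_sum b (Suc m) = digamma_rem_sum b m + digamma_rem (b * real (Suc m))"
    by (simp add: digamma_rem_sum_def)
  moreover have "real (Suc p) / (2 * b * real n) = real p / (2 * b * real n) + 1 / (2 * b * real n)"
    by (simp add: add_divide_distrib)
  ultimately show ?case using Suc m
    by (simp add: algebra_simps diff_divide_distrib)
qed

lemma mean_logdet_plus_J_rate:
  assumes "b > 0" "n > 0" "p \<le> n"
  shows "mean_logdet b n p + real n * J_rate (1 - real p / real n) =
    (ln_fact_rem n - ln_fact_rem (n - p)) - (harm n - harm (n - p)) / (2 * b)
    - (digamma_rem_sum b n - digamma_rem_sum b (n - p))
    + real p / (2 * b * real n) + real p * digamma_rem (b * real n)"
  using mult_J_rate_eq[of "n - p" n] assms
  by (simp add: mean_logdet_eq ln_fact_rem_def)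

lemma var_logdet_eq:
  assumes b: "b > 0" and n: "n > 0" and p: "p \<le> n"
  shows "var_logdet b n p = (harm n - harm (n - p)) / b
    + (trigamma_rem_sum b n - trigamma_rem_sum b (n - p))
    - real p / (b * real n) - real p * trigamma_rem (b * real n)"
  using p
proof (induction p)
  case 0
  then show ?case by (simp add: var_logdet_def)
next
  case (Suc p)
  then obtain m where m: "n - p = Suc m" "n - Suc p = m"
    by (metis Suc_diff_Suc Suc_le_eq)
  have "var_logdet b n (Suc p) =
      var_logdet b n p + (Polygamma 1 (b * real (Suc m)) - Polygamma 1 (b * real n))"
    using m by (simp add: var_logdet_def del: of_nat_Suc)
  moreover have "Polygamma 1 (b * real (Suc m)) = 1 / (b * real (Suc m)) + trigamma_rem (b * real (Suc m))"
    "Polygamma 1 (b * real n) = 1 / (b * real n) + trigamma_rem (b * real n)"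
    by (simp_all add: trigamma_rem_def)
  moreover have "harm (Suc m) / b = harm m / b + 1 / (b * real (Suc m))"
    using b by (simp add: harm_Suc field_simps del: of_nat_Suc)
  moreover have "trigamma_rem_sum b (Suc m) = trigamma_rem_sum b m + trigamma_rem (b * real (Suc m))"
    by (simp add: trigamma_rem_sum_def)
  moreover have "real (Suc p) / (b * real n) = real p / (b * real n) + 1 / (b * real n)"
    by (simp add: add_divide_distrib)
  ultimately show ?case using Suc m
    by (simp add: algebra_simps diff_divide_distrib)
qed

text \<open>In both exact formulas the value at b n is subtracted once for each of p \<le> n
  factors; quadratic decay of the remainder outweighs this multiplicity.\<close>

lemma mult_tendsto_0_of_inverse_square_bound:
  assumes b: "b > 0" and h: "\<And>x. x > 0 \<Longrightarrow> 0 \<le> h x" "\<And>x. x > 0 \<Longrightarrow> h x \<le> 1 / x\<^sup>2"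
  shows "(\<lambda>n. real n * h (b * real n)) \<longlonglongrightarrow> 0"
proof (rule tendsto_sandwich)
  show "\<forall>\<^sub>F n in sequentially. 0 \<le> real n * h (b * real n)"
    using eventually_gt_at_top[of 0] by eventually_elim (use b h in auto)
  show "\<forall>\<^sub>F n in sequentially. real n * h (b * real n) \<le> 1 / b\<^sup>2 * inverse (real n)"
    using eventually_gt_at_top[of 0]
  proof eventually_elim
    case (elim n)
    then have "real n * h (b * real n) \<le> real n * (1 / (b * real n)\<^sup>2)"
      using b by (intro mult_left_mono h) auto
    also have "\<dots> = 1 / b\<^sup>2 * inverse (real n)" using elim b by (simp add: field_simps power2_eq_square)
    finally show ?case .
  qed
  show "(\<lambda>n. 1 / b\<^sup>2 * inverse (real n)) \<longlonglongrightarrow> 0"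
    using tendsto_mult_left[OF lim_inverse_n, of "1 / b\<^sup>2"] by simp
qed simp

lemma mult_digamma_rem_tendsto_0:
  assumes b: "b > 0"
  shows "(\<lambda>n. real n * digamma_rem (b * real n)) \<longlonglongrightarrow> 0"
  by (rule mult_tendsto_0_of_inverse_square_bound[OF b]) (rule digamma_rem_bounds, assumption)+

lemma mult_trigamma_rem_tendsto_0:
  assumes b: "b > 0"
  shows "(\<lambda>n. real n * trigamma_rem (b * real n)) \<longlonglongrightarrow> 0"
  by (rule mult_tendsto_0_of_inverse_square_bound[OF b]) (rule trigamma_rem_nonneg trigamma_rem_bounds(2), assumption)+

section \<open>The bulk regime: fixed t < 1\<close>

lemma floor_fraction_LIMSEQ:
  assumes t: "0 \<le> t"
  shows "(\<lambda>n. real (nat \<lfloor>real n * t\<rfloor>) / real n) \<longlonglongrightarrow> t"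
proof (rule tendsto_sandwich)
  show "\<forall>\<^sub>F n in sequentially. t - 1 / real n \<le> real (nat \<lfloor>real n * t\<rfloor>) / real n"
    using eventually_gt_at_top[of 0]
  proof eventually_elim
    case (elim n)
    have "real n * t - 1 \<le> real (nat \<lfloor>real n * t\<rfloor>)" using t elim by linarith
    then have "(real n * t - 1) / real n \<le> real (nat \<lfloor>real n * t\<rfloor>) / real n"
      by (intro divide_right_mono) auto
    then show ?case using elim by (simp add: diff_divide_distrib)
  qed
  show "\<forall>\<^sub>F n in sequentially. real (nat \<lfloor>real n * t\<rfloor>) / real n \<le> t"
    using eventually_gt_at_top[of 0]
  proof eventually_elim
    case (elim n)
    have "real (nat \<lfloor>real n * t\<rfloor>) \<le> real n * t" using t elim by simp
    then show ?case using elim by (simp add: field_simps)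
  qed
  show "(\<lambda>n. t - 1 / real n) \<longlonglongrightarrow> t" by real_asymp
qed simp

lemma nat_floor_mult_le:
  assumes "0 \<le> t" "t \<le> 1"
  shows "nat \<lfloor>real n * t\<rfloor> \<le> n"
proof -
  have "real n * t \<le> real n * 1" using assms by (intro mult_left_mono) auto
  then have "\<lfloor>real n * t\<rfloor> \<le> int n" by linarith
  then show ?thesis by simp
qed

context
  fixes t :: real and m :: "nat \<Rightarrow> nat"
  assumes t: "0 \<le> t" "t < 1"
  defines "m \<equiv> \<lambda>n. n - nat \<lfloor>real n * t\<rfloor>"
begin

lemma floor_complement_fraction_LIMSEQ: "(\<lambda>n. real (m n) / real n) \<longlonglongrightarrow> 1 - t"
proof -
  have "(\<lambda>n. 1 - real (nat \<lfloor>real n * t\<rfloor>) / real n) \<longlonglongrightarrow> 1 - t"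
    using floor_fraction_LIMSEQ[OF t(1)] by (intro tendsto_intros)
  moreover have "\<forall>\<^sub>F n in sequentially. 1 - real (nat \<lfloor>real n * t\<rfloor>) / real n = real (m n) / real n"
    using eventually_gt_at_top[of 0]
    by eventually_elim
       (use t nat_floor_mult_le[of t] in \<open>simp add: m_def of_nat_diff field_simps\<close>)
  ultimately show ?thesis by (rule Lim_transform_eventually)
qed

lemma floor_complement_at_top: "filterlim m at_top sequentially"
proof -
  have "filterlim (\<lambda>n. real (m n) / real n * real n) at_top sequentially"
    using t by (intro filterlim_tendsto_pos_mult_at_top[OF floor_complement_fraction_LIMSEQ]
        filterlim_real_sequentially) auto
  moreover have "\<forall>\<^sub>F n in sequentially. real (m n) / real n * real n = real (m n)"
    using eventually_gt_at_top[of 0] by eventually_elim simp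
  ultimately have "filterlim (\<lambda>n. real (m n)) at_top sequentially"
    by (simp add: filterlim_cong)
  then show ?thesis by (simp add: filterlim_sequentially_iff_filterlim_real)
qed

lemma ln_floor_complement_LIMSEQ: "(\<lambda>n. ln (real n) - ln (real (m n))) \<longlonglongrightarrow> - ln (1 - t)"
proof -
  have "(\<lambda>n. - ln (real (m n) / real n)) \<longlonglongrightarrow> - ln (1 - t)"
    using t by (intro tendsto_intros floor_complement_fraction_LIMSEQ) auto
  moreover have "\<forall>\<^sub>F n in sequentially. - ln (real (m n) / real n) = ln (real n) - ln (real (m n))"
    using eventually_gt_at_top[of 0] filterlim_at_top[THEN iffD1, OF floor_complement_at_top, rule_format, of 1]
    by eventually_elim (simp add: ln_div)
  ultimately show ?thesis by (rule Lim_transform_eventually)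
qed

text \<open>The constant L cancels because both n and m n tend to infinity, the latter by t < 1;
  what survives is c times the limit of ln (n / m n). It is applied with c = 1/2 to the Stirling
  remainder, c = 1 to harmonic numbers and c = 0 to the remainder sums.\<close>

lemma diff_log_growth_LIMSEQ:
  assumes "(\<lambda>n. a n - c * ln (real n)) \<longlonglongrightarrow> L"
  shows "(\<lambda>n. a n - a (m n)) \<longlonglongrightarrow> - c * ln (1 - t)"
proof -
  have "(\<lambda>n. (a n - c * ln (real n)) - (a (m n) - c * ln (real (m n))) + c * (ln (real n) - ln (real (m n))))
      \<longlonglongrightarrow> L - L + c * (- ln (1 - t))"
    by (intro tendsto_intros assms ln_floor_complement_LIMSEQ
          filterlim_compose[OF assms floor_complement_at_top])
  then show ?thesis by (simp add: algebra_simps)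
qed

lemma mult_floor_tendsto_0:
  assumes "(\<lambda>n. real n * h n) \<longlonglongrightarrow> 0"
  shows "(\<lambda>n. real (nat \<lfloor>real n * t\<rfloor>) * h n) \<longlonglongrightarrow> 0"
proof -
  have "(\<lambda>n. real (nat \<lfloor>real n * t\<rfloor>) / real n * (real n * h n)) \<longlonglongrightarrow> t * 0"
    by (intro tendsto_mult floor_fraction_LIMSEQ t assms)
  moreover have "\<forall>\<^sub>F n in sequentially. real (nat \<lfloor>real n * t\<rfloor>) / real n * (real n * h n) =
      real (nat \<lfloor>real n * t\<rfloor>) * h n"
    using eventually_gt_at_top[of 0] by eventually_elim simp
  ultimately show ?thesis by (simp add: Lim_transform_eventually)
qed

lemma mean_logdet_bulk_LIMSEQ:
  assumes b: "b > 0"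
  shows "(\<lambda>n. mean_logdet b n (nat \<lfloor>real n * t\<rfloor>) + real n * J_rate (1 - real (nat \<lfloor>real n * t\<rfloor>) / real n))
    \<longlonglongrightarrow> t / (2 * b) + (1 / (2 * b) - 1 / 2) * ln (1 - t)"
proof -
  let ?p = "\<lambda>n. nat \<lfloor>real n * t\<rfloor>"
  have harm: "(\<lambda>n. harm n - 1 * ln (real n)) \<longlonglongrightarrow> (euler_mascheroni :: real)"
    using euler_mascheroni_LIMSEQ by simp
  \<comment> \<open>With c = 0 the difference of partial sums of a convergent series tends to 0, so
    the integral of \<open>K1\<close> leaves no trace in the bulk.\<close>
  have R: "(\<lambda>n. digamma_rem_sum b n - 0 * ln (real n)) \<longlonglongrightarrow>
      integral {0<..} (\<lambda>s. s * f_aux s / (exp (b * s) - 1))"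
    using digamma_rem_sum_LIMSEQ[OF b] by simp
  have "(\<lambda>n. (ln_fact_rem n - ln_fact_rem (m n)) - (harm n - harm (m n)) / (2 * b)
    - (digamma_rem_sum b n - digamma_rem_sum b (m n))
    + real (?p n) / real n / (2 * b) + real (?p n) * digamma_rem (b * real n)) \<longlonglongrightarrow>
    - (1 / 2) * ln (1 - t) - (- 1 * ln (1 - t)) / (2 * b) - (- 0 * ln (1 - t)) + t / (2 * b) + 0"
    using b
    by (intro tendsto_add tendsto_diff tendsto_divide tendsto_const diff_log_growth_LIMSEQ[OF ln_fact_rem_LIMSEQ]
        diff_log_growth_LIMSEQ[OF harm] diff_log_growth_LIMSEQ[OF R] floor_fraction_LIMSEQ t
        mult_floor_tendsto_0 mult_digamma_rem_tendsto_0) auto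
  also have "- (1 / 2) * ln (1 - t) - (- 1 * ln (1 - t)) / (2 * b) - (- 0 * ln (1 - t)) + t / (2 * b) + 0 =
      t / (2 * b) + (1 / (2 * b) - 1 / 2) * ln (1 - t)"
    by (simp add: algebra_simps)
  finally show ?thesis
  proof (rule Lim_transform_eventually)
    show "\<forall>\<^sub>F n in sequentially. (ln_fact_rem n - ln_fact_rem (m n)) - (harm n - harm (m n)) / (2 * b)
    - (digamma_rem_sum b n - digamma_rem_sum b (m n))
    + real (?p n) / real n / (2 * b) + real (?p n) * digamma_rem (b * real n) =
      mean_logdet b n (?p n) + real n * J_rate (1 - real (?p n) / real n)"
      using eventually_gt_at_top[of 0]
    proof eventually_elim
      case (elim n)
      have p: "?p n \<le> n" using t by (intro nat_floor_mult_le) auto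
      show ?case unfolding mean_logdet_plus_J_rate[OF b elim p] m_def by (simp add: mult_ac)
    qed
  qed
qed

lemma var_logdet_bulk_LIMSEQ:
  assumes b: "b > 0"
  shows "(\<lambda>n. var_logdet b n (nat \<lfloor>real n * t\<rfloor>)) \<longlonglongrightarrow> (- ln (1 - t) - t) / b"
proof -
  let ?p = "\<lambda>n. nat \<lfloor>real n * t\<rfloor>"
  have harm: "(\<lambda>n. harm n - 1 * ln (real n)) \<longlonglongrightarrow> (euler_mascheroni :: real)"
    using euler_mascheroni_LIMSEQ by simp
  have R: "(\<lambda>n. trigamma_rem_sum b n - 0 * ln (real n)) \<longlonglongrightarrow>
      integral {0<..} (\<lambda>s. s * (s * f_aux s + 1 / 2) / (exp (b * s) - 1))"
    using trigamma_rem_sum_LIMSEQ[OF b] by simp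
  have "(\<lambda>n. (harm n - harm (m n)) / b + (trigamma_rem_sum b n - trigamma_rem_sum b (m n))
    - real (?p n) / real n / b - real (?p n) * trigamma_rem (b * real n)) \<longlonglongrightarrow>
    (- 1 * ln (1 - t)) / b + (- 0 * ln (1 - t)) - t / b - 0"
    using b
    by (intro tendsto_add tendsto_diff tendsto_divide tendsto_const
        diff_log_growth_LIMSEQ[OF harm] diff_log_growth_LIMSEQ[OF R] floor_fraction_LIMSEQ t
        mult_floor_tendsto_0 mult_trigamma_rem_tendsto_0) auto
  also have "(- 1 * ln (1 - t)) / b + (- 0 * ln (1 - t)) - t / b - 0 = (- ln (1 - t) - t) / b"
    by (simp add: diff_divide_distrib)
  finally show ?thesis
  proof (rule Lim_transform_eventually)
    show "\<forall>\<^sub>F n in sequentially. (harm n - harm (m n)) / b + (trigamma_rem_sum b n - trigamma_rem_sum b (m n))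
      - real (?p n) / real n / b - real (?p n) * trigamma_rem (b * real n) = var_logdet b n (?p n)"
      using eventually_gt_at_top[of 0]
    proof eventually_elim
      case (elim n)
      have p: "?p n \<le> n" using t by (intro nat_floor_mult_le) auto
      show ?case unfolding var_logdet_eq[OF b elim p] m_def by (simp add: mult_ac)
    qed
  qed
qed

end

text \<open>Here n - p = 0, so the full constants remain: ln (2 pi)/2 from Stirling, the Euler
  constant from the harmonic number, the whole remainder series, and 1/(2b) from n copies of 1/(2 b
  n).\<close>

lemma mean_logdet_edge_LIMSEQ:
  assumes b: "b > 0"
  shows "(\<lambda>n. mean_logdet b n n + real n + (1 / (2 * b) - 1 / 2) * ln (real n)) \<longlonglongrightarrow>
    ln (2 * pi) / 2 + (1 - euler_mascheroni) / (2 * b)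
    - integral {0<..} (\<lambda>s. s * f_aux s / (exp (b * s) - 1))"
proof -
  have "(\<lambda>n. (ln_fact_rem n - 1 / 2 * ln (real n)) - (harm n - ln (real n)) / (2 * b)
      - digamma_rem_sum b n + 1 / (2 * b) + real n * digamma_rem (b * real n)) \<longlonglongrightarrow>
    ln (2 * pi) / 2 - euler_mascheroni / (2 * b)
      - integral {0<..} (\<lambda>s. s * f_aux s / (exp (b * s) - 1)) + 1 / (2 * b) + 0"
    using b by (intro tendsto_intros ln_fact_rem_LIMSEQ euler_mascheroni_LIMSEQ
        digamma_rem_sum_LIMSEQ mult_digamma_rem_tendsto_0) auto
  also have "ln (2 * pi) / 2 - euler_mascheroni / (2 * b)
      - integral {0<..} (\<lambda>s. s * f_aux s / (exp (b * s) - 1)) + 1 / (2 * b) + 0 =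
    ln (2 * pi) / 2 + (1 - euler_mascheroni) / (2 * b)
      - integral {0<..} (\<lambda>s. s * f_aux s / (exp (b * s) - 1))"
    by (simp add: diff_divide_distrib)
  finally show ?thesis
  proof (rule Lim_transform_eventually)
    show "\<forall>\<^sub>F n in sequentially. (ln_fact_rem n - 1 / 2 * ln (real n)) - (harm n - ln (real n)) / (2 * b)
      - digamma_rem_sum b n + 1 / (2 * b) + real n * digamma_rem (b * real n) =
      mean_logdet b n n + real n + (1 / (2 * b) - 1 / 2) * ln (real n)"
      using eventually_gt_at_top[of 0]
    proof eventually_elim
      case (elim n)
      then show ?case using mean_logdet_plus_J_rate[OF b, of n n]
        by (simp add: J_rate_def ln_fact_rem_def[of 0] harm_def[of 0] digamma_rem_sum_def[of b 0]
            algebra_simps diff_divide_distrib)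
    qed
  qed
qed

text \<open>The harmonic number contributes the logarithm and the Euler constant, and the n-fold
  subtraction of 1/(b n) contributes -1/b.\<close>

lemma var_logdet_edge_LIMSEQ:
  assumes b: "b > 0"
  shows "(\<lambda>n. var_logdet b n n - ln (real n) / b) \<longlonglongrightarrow>
    (euler_mascheroni - 1) / b + integral {0<..} (\<lambda>s. s * (s * f_aux s + 1 / 2) / (exp (b * s) - 1))"
proof -
  have "(\<lambda>n. (harm n - ln (real n)) / b + trigamma_rem_sum b n - 1 / b
        - real n * trigamma_rem (b * real n)) \<longlonglongrightarrow>
    euler_mascheroni / b + integral {0<..} (\<lambda>s. s * (s * f_aux s + 1 / 2) / (exp (b * s) - 1)) - 1 / b - 0"
    using b by (intro tendsto_intros euler_mascheroni_LIMSEQ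
        trigamma_rem_sum_LIMSEQ mult_trigamma_rem_tendsto_0) auto
  also have "euler_mascheroni / b + integral {0<..} (\<lambda>s. s * (s * f_aux s + 1 / 2) / (exp (b * s) - 1)) - 1 / b - 0 =
    (euler_mascheroni - 1) / b + integral {0<..} (\<lambda>s. s * (s * f_aux s + 1 / 2) / (exp (b * s) - 1))"
    by (simp add: diff_divide_distrib)
  finally show ?thesis
  proof (rule Lim_transform_eventually)
    show "\<forall>\<^sub>F n in sequentially. (harm n - ln (real n)) / b + trigamma_rem_sum b n - 1 / b
        - real n * trigamma_rem (b * real n) = var_logdet b n n - ln (real n) / b"
      using eventually_gt_at_top[of 0]
    proof eventually_elim
      case (elim n)
      then show ?case using var_logdet_eq[OF b, of n n]
        by (simp add: harm_def[of 0] trigamma_rem_sum_def[of b 0] diff_divide_distrib)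
    qed
  qed
qed

text \<open>Logarithmic growth along the sequence becomes a bound at n valid for all earlier
  indices; this is the source of uniformity in p.\<close>

lemma log_growth_bound:
  fixes a :: "nat \<Rightarrow> real"
  assumes "(\<lambda>n. a n - c * ln (real n)) \<longlonglongrightarrow> L" and c: "c \<ge> 0"
  obtains C where "\<And>m n. m \<le> n \<Longrightarrow> \<bar>a m\<bar> \<le> C + c * ln (real n)"
proof -
  obtain C where C: "\<And>n. \<bar>a n - c * ln (real n)\<bar> \<le> C"
    using convergent_imp_Bseq[OF convergentI[OF assms(1)]] by (auto simp: Bseq_def)
  have "\<bar>a m\<bar> \<le> C + c * ln (real n)" if "m \<le> n" for m n
  proof -
    \<comment> \<open>The convention ln 0 = 0 lets the index 0, reached at p = n, pass without
      exception.\<close>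
    have "0 \<le> ln (real m)" "ln (real m) \<le> ln (real n)"
      using that by (cases "m = 0"; cases "n = 0"; simp)+
    then have "0 \<le> c * ln (real m)" "c * ln (real m) \<le> c * ln (real n)"
      using c by (auto intro: mult_left_mono)
    then show ?thesis using C[of m] by linarith
  qed
  then show ?thesis by (rule that)
qed

text \<open>Each term of the exact formula is bounded separately. A bound O(ln n) suffices, since
  the uniform statements divide by n.\<close>

lemma mean_logdet_uniform_bound:
  assumes b: "b > 0"
  obtains C D where "\<And>n p. 0 < n \<Longrightarrow> p \<le> n \<Longrightarrow>
    \<bar>mean_logdet b n p + real n * J_rate (1 - real p / real n)\<bar> \<le> C + D * ln (real n)"
proof -
  obtain C1 where C1: "\<And>m n. m \<le> n \<Longrightarrow> \<bar>ln_fact_rem m\<bar> \<le> C1 + 1 / 2 * ln (real n)"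
    using log_growth_bound[OF ln_fact_rem_LIMSEQ] by auto
  obtain C2 where C2: "\<And>m n. m \<le> n \<Longrightarrow> \<bar>harm m\<bar> \<le> C2 + 1 * ln (real n)"
    using log_growth_bound[of harm 1] euler_mascheroni_LIMSEQ by auto
  obtain C3 where C3: "\<And>m n. m \<le> n \<Longrightarrow> \<bar>digamma_rem_sum b m\<bar> \<le> C3 + 0 * ln (real n)"
    using log_growth_bound[of "digamma_rem_sum b" 0] digamma_rem_sum_LIMSEQ[OF b] by auto
  obtain C4 where C4: "\<And>n. \<bar>real n * digamma_rem (b * real n)\<bar> \<le> C4"
    using convergent_imp_Bseq[OF convergentI[OF mult_digamma_rem_tendsto_0[OF b]]] by (auto simp: Bseq_def)
  show ?thesis
  proof (rule that)
    fix n p :: nat assume n: "0 < n" and p: "p \<le> n"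
    have diff_le: "\<bar>a n - a (n - p)\<bar> \<le> 2 * B" if "\<And>m. m \<le> n \<Longrightarrow> \<bar>a m\<bar> \<le> B"
      for a :: "nat \<Rightarrow> real" and B
      using that[OF order_refl] that[OF diff_le_self, of p] by linarith
    have tri: "\<bar>u - v - w + y + z\<bar> \<le> U + V + W + Y + Z"
      if "\<bar>u\<bar> \<le> U" "\<bar>v\<bar> \<le> V" "\<bar>w\<bar> \<le> W" "\<bar>y\<bar> \<le> Y" "\<bar>z\<bar> \<le> Z" for u v w y z U V W Y Z :: real
      using that by linarith
    have "\<bar>mean_logdet b n p + real n * J_rate (1 - real p / real n)\<bar> \<le>
        2 * (C1 + 1 / 2 * ln (real n)) + (2 * (C2 + 1 * ln (real n))) / (2 * b)
        + 2 * (C3 + 0 * ln (real n)) + 1 / (2 * b) + C4"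
      unfolding mean_logdet_plus_J_rate[OF b n p]
    proof (rule tri)
      have "\<bar>harm n - harm (n - p)\<bar> \<le> 2 * (C2 + 1 * ln (real n))"
        using C2 by (rule diff_le)
      then show "\<bar>(harm n - harm (n - p)) / (2 * b)\<bar> \<le> (2 * (C2 + 1 * ln (real n))) / (2 * b)"
        using b unfolding abs_divide by (simp add: divide_right_mono)
      show "\<bar>real p / (2 * b * real n)\<bar> \<le> 1 / (2 * b)"
        using n p b by (simp add: field_simps)
      show "\<bar>real p * digamma_rem (b * real n)\<bar> \<le> C4"
      proof (rule order_trans[OF _ C4[of n]])
        show "\<bar>real p * digamma_rem (b * real n)\<bar> \<le> \<bar>real n * digamma_rem (b * real n)\<bar>"
          using p unfolding abs_mult by (intro mult_right_mono) auto
      qed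
    qed (intro diff_le C1 C3; assumption)+
    then show "\<bar>mean_logdet b n p + real n * J_rate (1 - real p / real n)\<bar>
        \<le> (2 * C1 + C2 / b + 2 * C3 + 1 / (2 * b) + C4) + (1 + 1 / b) * ln (real n)"
      by (simp add: algebra_simps add_divide_distrib)
  qed
qed

section \<open>Closed forms of the limiting drift and variance\<close>

lemma integral_d_G:
  assumes "0 \<le> t" "t < 1" "\<beta> > 0"
  shows "integral {0..t} (d_G \<beta>) = t / \<beta> + (1 / \<beta> - 1 / 2) * ln (1 - t)"
proof -
  define F where "F = (\<lambda>s. s / \<beta> + (1 / \<beta> - 1 / 2) * ln (1 - s))"
  have "(d_G \<beta> has_integral (F t - F 0)) {0..t}"
  proof (rule fundamental_theorem_of_calculus[OF assms(1)])
    fix s assume "s \<in> {0..t}"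
    then have s: "1 - s > 0" using assms by simp
    have "(F has_real_derivative 1 / \<beta> - (1 / \<beta> - 1 / 2) / (1 - s)) (at s)"
      unfolding F_def using s \<open>\<beta> > 0\<close> by (auto intro!: derivative_eq_intros)
    also have "1 / \<beta> - (1 / \<beta> - 1 / 2) / (1 - s) = d_G \<beta> s"
      by (simp add: d_G_def left_diff_distrib diff_divide_distrib)
    finally have "(F has_real_derivative d_G \<beta> s) (at s)" .
    then show "(F has_vector_derivative d_G \<beta> s) (at s within {0..t})"
      by (rule has_vector_derivative_at_within[OF has_real_derivative_iff_has_vector_derivative[THEN iffD1]])
  qed
  then show ?thesis by (simp add: integral_unique F_def)
qed

lemma integral_sigma_G:
  assumes "0 \<le> t" "t < 1" "\<beta> > 0"
  shows "integral {0..t} (\<lambda>s. (sigma_G \<beta> s)\<^sup>2) = 2 / \<beta> * (- ln (1 - t) - t)"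
proof -
  define F where "F = (\<lambda>s. 2 / \<beta> * (- ln (1 - s) - s))"
  have "((\<lambda>s. (sigma_G \<beta> s)\<^sup>2) has_integral (F t - F 0)) {0..t}"
  proof (rule fundamental_theorem_of_calculus[OF assms(1)])
    fix s assume s_in: "s \<in> {0..t}"
    then have s: "1 - s > 0" using assms by simp
    have "(sigma_G \<beta> s)\<^sup>2 = 2 * s / (\<beta> * (1 - s))"
      using s_in s assms unfolding sigma_G_def by (intro real_sqrt_pow2) auto
    also have "\<dots> = 2 / \<beta> * (1 / (1 - s) - 1)" using s assms by (simp add: field_simps)
    finally have "(F has_real_derivative (sigma_G \<beta> s)\<^sup>2) (at s)"
      unfolding F_def using s \<open>\<beta> > 0\<close> by (auto intro!: derivative_eq_intros)
    then show "(F has_vector_derivative (sigma_G \<beta> s)\<^sup>2) (at s within {0..t})"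
      by (rule has_vector_derivative_at_within[OF has_real_derivative_iff_has_vector_derivative[THEN iffD1]])
  qed
  then show ?thesis by (simp add: integral_unique F_def)
qed

section \<open>The log-determinant process\<close>

text \<open>At u = 0 the prescribed value 1 is the limit, as u ln u tends to 0. Uniform continuity
  on [0,1] is what later allows t to be replaced by p/n.\<close>

lemma continuous_on_J_rate: "continuous_on {0..1} J_rate"
  unfolding continuous_on_eq_continuous_within continuous_within
proof
  fix u :: real assume u: "u \<in> {0..1}"
  have "((\<lambda>u. u * ln u - u + 1) \<longlongrightarrow> J_rate u) (at u within {0..1})"
  proof (cases "u = 0")
    case True
    have "((\<lambda>u::real. u * ln u - u + 1) \<longlongrightarrow> 1) (at_right 0)" by real_asymp
    then show ?thesis by (simp add: True J_rate_def at_within_Icc_at_right)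
  next
    case False
    then have "((\<lambda>u::real. u * ln u - u + 1) \<longlongrightarrow> u * ln u - u + 1) (at u within {0..1})"
      by (intro tendsto_intros) auto
    then show ?thesis using u False by (simp add: J_rate_def)
  qed
  moreover have "\<forall>\<^sub>F v in at u within {0..1}. v * ln v - v + 1 = J_rate v"
    by (auto simp: eventually_at_filter J_rate_def)
  ultimately show "(J_rate \<longlongrightarrow> J_rate u) (at u within {0..1})"
    by (rule Lim_transform_eventually)
qed

lemma J_rate_uniform_modulus:
  assumes "e > 0"
  obtains d where "d > 0"
    "\<And>u v. u \<in> {0..1} \<Longrightarrow> v \<in> {0..1} \<Longrightarrow> \<bar>u - v\<bar> < d \<Longrightarrow> \<bar>J_rate u - J_rate v\<bar> < e"
proof -
  have "uniformly_continuous_on {0..1} J_rate"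
    by (intro compact_uniformly_continuous continuous_on_J_rate compact_Icc)
  then show ?thesis
    using assms that unfolding uniformly_continuous_on_def dist_real_def by (metis (no_types, lifting))
qed

lemma affine_ln_over_n_tendsto_0: "(\<lambda>n. (C + D * ln (real n)) / real n) \<longlonglongrightarrow> 0"
proof -
  have "(\<lambda>n. C * (1 / real n) + D * (ln (real n) / real n)) \<longlonglongrightarrow> C * 0 + D * 0"
    by (intro tendsto_intros)
  then show ?thesis by (simp add: add_divide_distrib)
qed

lemma sum_from_2:
  fixes g :: "nat \<Rightarrow> real"
  assumes "g 1 = 0"
  shows "(\<Sum>k=1..p. g k) = (\<Sum>k=2..p. g k)"
  using assms by (intro sum.mono_neutral_right) (auto simp: not_le numeral_2_eq_2 less_Suc_eq_le le_Suc_eq)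

section \<open>Exact moments and deviations of the random process\<close>

context
  fixes M :: "'a measure" and \<beta> :: real and \<rho> :: "nat \<Rightarrow> nat \<Rightarrow> 'a \<Rightarrow> real"
  assumes beta_pos: "\<beta> > 0"
    and M: "prob_space M"
    and rho1: "\<And>n x. n \<ge> 1 \<Longrightarrow> x \<in> space M \<Longrightarrow> \<rho> n 1 x = 1"
    and rho_distr: "\<And>n k. 2 \<le> k \<Longrightarrow> k \<le> n \<Longrightarrow>
        distributed M lborel (\<rho> n k)
          (\<lambda>x. ennreal (beta_density (\<beta> / 2 * real (n - k + 1)) (\<beta> / 2 * real (k - 1)) x))"
    and rho_indep: "\<And>n. prob_space.indep_vars M (\<lambda>_. borel) (\<rho> n) {2..n}"
begin

interpretation prob_space M by (rule M)

lemma ln_rho_moments: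
  assumes k: "2 \<le> k" "k \<le> n"
  shows "integrable M (\<lambda>x. ln (\<rho> n k x))" "integrable M (\<lambda>x. (ln (\<rho> n k x))\<^sup>2)"
    "expectation (\<lambda>x. ln (\<rho> n k x)) = Digamma (\<beta> / 2 * real (n - k + 1)) - Digamma (\<beta> / 2 * real n)"
    "variance (\<lambda>x. ln (\<rho> n k x)) = Polygamma 1 (\<beta> / 2 * real (n - k + 1)) - Polygamma 1 (\<beta> / 2 * real n)"
proof -
  have pos: "\<beta> / 2 * real (n - k + 1) > 0" "\<beta> / 2 * real (k - 1) > 0"
    using beta_pos k by auto
  \<comment> \<open>The two Beta parameters of every factor add up to b n, so the subtracted digamma
    and trigamma values do not depend on k.\<close>
  have "real (n - k + 1) + real (k - 1) = real n"
    using k unfolding of_nat_add[symmetric] by simp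
  then have sum: "\<beta> / 2 * real (n - k + 1) + \<beta> / 2 * real (k - 1) = \<beta> / 2 * real n"
    unfolding distrib_left[symmetric] by simp
  note D = rho_distr[OF k]
  show "integrable M (\<lambda>x. ln (\<rho> n k x))" "integrable M (\<lambda>x. (ln (\<rho> n k x))\<^sup>2)"
    using beta_distributed_ln_power(1)[OF pos D, of 1] beta_distributed_ln_power(1)[OF pos D, of 2] by auto
  show "expectation (\<lambda>x. ln (\<rho> n k x)) = Digamma (\<beta> / 2 * real (n - k + 1)) - Digamma (\<beta> / 2 * real n)"
    using beta_distributed_expectation_ln[OF pos D] unfolding sum .
  show "variance (\<lambda>x. ln (\<rho> n k x)) = Polygamma 1 (\<beta> / 2 * real (n - k + 1)) - Polygamma 1 (\<beta> / 2 * real n)"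
    using beta_distributed_variance_ln[OF pos D M] unfolding sum .
qed

text \<open>The first factor contributes ln 1 = 0. It is prescribed on \<open>space M\<close> only,
  so moments and measurability are transferred by congruence on that set.\<close>

lemma log_Delta_eq:
  assumes "p \<le> n" "x \<in> space M"
  shows "log_Delta \<rho> n p x = (\<Sum>k=2..p. ln (\<rho> n k x))"
proof (cases "p = 0")
  case False
  then have "{1..p} = insert 1 {2..p}" by auto
  then show ?thesis using rho1[of n x] assms False by (simp add: log_Delta_def)
qed (simp add: log_Delta_def)

lemma log_Delta_moments:
  assumes p: "p \<le> n"
  shows "expectation (log_Delta \<rho> n p) = mean_logdet (\<beta> / 2) n p"
    "variance (log_Delta \<rho> n p) = var_logdet (\<beta> / 2) n p"
    "integrable M (\<lambda>x. (log_Delta \<rho> n p x)\<^sup>2)"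
    "random_variable borel (log_Delta \<rho> n p)"
proof -
  define S where "S x = (\<Sum>k=2..p. ln (\<rho> n k x))" for x
  have S: "log_Delta \<rho> n p x = S x" if "x \<in> space M" for x
    using log_Delta_eq[OF p that] by (simp add: S_def)
  have indep: "indep_vars (\<lambda>_. borel) (\<lambda>k x. ln (\<rho> n k x)) {2..p}"
    by (rule indep_vars_compose2[OF indep_vars_subset[OF rho_indep[of n]]]) (use p in auto)
  have int: "integrable M (\<lambda>x. ln (\<rho> n k x))" "integrable M (\<lambda>x. (ln (\<rho> n k x))\<^sup>2)" if "k \<in> {2..p}" for k
    using ln_rho_moments[of k n] that p by auto
  have E: "expectation (log_Delta \<rho> n p) = expectation S"
    by (intro Bochner_Integration.integral_cong) (auto simp: S)
  also have "\<dots> = (\<Sum>k=2..p. expectation (\<lambda>x. ln (\<rho> n k x)))"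
    unfolding S_def using int(1) by (intro Bochner_Integration.integral_sum) auto
  also have "\<dots> = (\<Sum>k=2..p. Digamma (\<beta> / 2 * real (n - k + 1)) - Digamma (\<beta> / 2 * real n))"
    using p by (intro sum.cong refl ln_rho_moments) auto
  also have "\<dots> = mean_logdet (\<beta> / 2) n p"
  proof (cases "p = 0")
    case False
    then show ?thesis unfolding mean_logdet_def
      using p by (intro sum_from_2[symmetric]) simp
  qed (simp add: mean_logdet_def)
  finally show "expectation (log_Delta \<rho> n p) = mean_logdet (\<beta> / 2) n p" .
  have "variance (log_Delta \<rho> n p) = variance S"
    unfolding E by (intro Bochner_Integration.integral_cong) (auto simp: S)
  also have "\<dots> = (\<Sum>k=2..p. variance (\<lambda>x. ln (\<rho> n k x)))"
    unfolding S_def by (rule variance_sum_indep(2)[OF _ indep int]) auto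
  also have "\<dots> = (\<Sum>k=2..p. Polygamma 1 (\<beta> / 2 * real (n - k + 1)) - Polygamma 1 (\<beta> / 2 * real n))"
    using p by (intro sum.cong refl ln_rho_moments) auto
  also have "\<dots> = var_logdet (\<beta> / 2) n p"
  proof (cases "p = 0")
    case False
    then show ?thesis unfolding var_logdet_def
      using p by (intro sum_from_2[symmetric]) simp
  qed (simp add: var_logdet_def)
  finally show "variance (log_Delta \<rho> n p) = var_logdet (\<beta> / 2) n p" .
  have "integrable M (\<lambda>x. (S x)\<^sup>2)"
    unfolding S_def by (rule variance_sum_indep(1)[OF _ indep int]) auto
  then show "integrable M (\<lambda>x. (log_Delta \<rho> n p x)\<^sup>2)"
    by (rule Bochner_Integration.integrable_cong[THEN iffD2, rotated -1]) (auto simp: S)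
  have "S \<in> borel_measurable M"
    unfolding S_def[abs_def] using int(1) by (intro borel_measurable_sum) auto
  then show "random_variable borel (log_Delta \<rho> n p)"
    by (rule measurable_cong[THEN iffD2, rotated]) (auto simp: S)
qed

text \<open>Trigamma is decreasing, so every summand is nonnegative; one variance, that at p = n,
  then serves all p.\<close>

lemma var_logdet_mono:
  assumes "p \<le> n"
  shows "var_logdet (\<beta> / 2) n p \<le> var_logdet (\<beta> / 2) n n"
  unfolding var_logdet_def
proof (rule sum_mono2)
  fix k assume k: "k \<in> {1..n} - {1..p}"
  have "\<beta> / 2 * real (n - k + 1) \<le> \<beta> / 2 * real n" using beta_pos k by (intro mult_left_mono) auto
  moreover have "\<beta> / 2 * real (n - k + 1) > 0" using beta_pos by auto
  ultimately show "0 \<le> Polygamma 1 (\<beta> / 2 * real (n - k + 1)) - Polygamma 1 (\<beta> / 2 * real n)"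
    using Polygamma_real_strict_antimono[of "\<beta> / 2 * real (n - k + 1)" "\<beta> / 2 * real n" 1]
    unfolding le_less by fastforce
qed (use assms in auto)

text \<open>Each of the n events costs at most the largest variance over (e n)^2, so a single factor
  1/n is left. The index p = 0 is absent because both sums are empty there.\<close>

lemma prob_max_deviation_le:
  assumes n: "n > 0" and e: "e > 0"
  shows "prob (\<Union>p\<in>{1..n}. {x \<in> space M. \<bar>log_Delta \<rho> n p x - mean_logdet (\<beta> / 2) n p\<bar> \<ge> e * real n})
    \<le> var_logdet (\<beta> / 2) n n / real n / e\<^sup>2"
proof -
  let ?B = "\<lambda>p. {x \<in> space M. \<bar>log_Delta \<rho> n p x - mean_logdet (\<beta> / 2) n p\<bar> \<ge> e * real n}"
  have "prob (\<Union>p\<in>{1..n}. ?B p) \<le> (\<Sum>p=1..n. prob (?B p))"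
    using log_Delta_moments(4) by (intro finite_measure_subadditive_finite) auto
  also have "\<dots> \<le> (\<Sum>p=1..n. var_logdet (\<beta> / 2) n n / (e * real n)\<^sup>2)"
  proof (rule sum_mono)
    fix p assume p: "p \<in> {1..n}"
    then have pn: "p \<le> n" by simp
    have "prob {x \<in> space M. e * real n \<le> \<bar>log_Delta \<rho> n p x - expectation (log_Delta \<rho> n p)\<bar>}
        \<le> variance (log_Delta \<rho> n p) / (e * real n)\<^sup>2"
      by (rule Chebyshev_inequality[OF log_Delta_moments(4,3)[OF pn]]) (use e n in simp)
    then have "prob (?B p) \<le> var_logdet (\<beta> / 2) n p / (e * real n)\<^sup>2"
      unfolding log_Delta_moments(2)[OF pn] unfolding log_Delta_moments(1)[OF pn] .
    also have "\<dots> \<le> var_logdet (\<beta> / 2) n n / (e * real n)\<^sup>2"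
      by (intro divide_right_mono var_logdet_mono pn) simp
    finally show "prob (?B p) \<le> var_logdet (\<beta> / 2) n n / (e * real n)\<^sup>2" .
  qed
  also have "\<dots> = var_logdet (\<beta> / 2) n n / real n / e\<^sup>2"
    using n e by (simp add: field_simps power2_eq_square)
  finally show ?thesis .
qed

lemma var_logdet_over_n_tendsto_0: "(\<lambda>n. var_logdet (\<beta> / 2) n n / real n) \<longlonglongrightarrow> 0"
proof -
  have b: "\<beta> / 2 > 0" using beta_pos by simp
  obtain L where "(\<lambda>n. var_logdet (\<beta> / 2) n n - ln (real n) / (\<beta> / 2)) \<longlonglongrightarrow> L"
    using var_logdet_edge_LIMSEQ[OF b] by blast
  then have "(\<lambda>n. (var_logdet (\<beta> / 2) n n - ln (real n) / (\<beta> / 2)) * (1 / real n)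
      + (0 + 2 / \<beta> * ln (real n)) / real n) \<longlonglongrightarrow> L * 0 + 0"
    by (intro tendsto_add tendsto_mult affine_ln_over_n_tendsto_0 lim_1_over_n)
  then show ?thesis by (simp add: diff_divide_distrib)
qed

lemma mean_uniform_LIMSEQ:
  "(\<lambda>n. SUP p\<in>{1..n}. \<bar>(1 / real n) * expectation (log_Delta \<rho> n p) + J_rate (1 - real p / real n)\<bar>)
    \<longlonglongrightarrow> 0"
proof -
  have b: "\<beta> / 2 > 0" using beta_pos by simp
  obtain C D where CD: "\<And>n p. 0 < n \<Longrightarrow> p \<le> n \<Longrightarrow>
      \<bar>mean_logdet (\<beta> / 2) n p + real n * J_rate (1 - real p / real n)\<bar> \<le> C + D * ln (real n)"
    by (rule mean_logdet_uniform_bound[OF b]) blast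
  have le: "\<bar>(1 / real n) * expectation (log_Delta \<rho> n p) + J_rate (1 - real p / real n)\<bar>
      \<le> (C + D * ln (real n)) / real n" if "p \<in> {1..n}" for n p
  proof -
    have "(1 / real n) * expectation (log_Delta \<rho> n p) + J_rate (1 - real p / real n) =
        (mean_logdet (\<beta> / 2) n p + real n * J_rate (1 - real p / real n)) / real n"
      using that log_Delta_moments(1)[of p n] by (simp add: add_divide_distrib)
    then show ?thesis using CD[of n p] that by (simp add: divide_right_mono)
  qed
  have "\<forall>\<^sub>F n in sequentially. 0 \<le> (SUP p\<in>{1..n}.
      \<bar>(1 / real n) * expectation (log_Delta \<rho> n p) + J_rate (1 - real p / real n)\<bar>)"
    using eventually_gt_at_top[of 0]
  proof eventually_elim
    case (elim n)
    show ?case by (rule cSUP_upper2[of _ _ 1]) (use elim in auto)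
  qed
  moreover have "\<forall>\<^sub>F n in sequentially. (SUP p\<in>{1..n}.
      \<bar>(1 / real n) * expectation (log_Delta \<rho> n p) + J_rate (1 - real p / real n)\<bar>)
      \<le> (C + D * ln (real n)) / real n"
    using eventually_gt_at_top[of 0]
  proof eventually_elim
    case (elim n)
    show ?case by (rule cSUP_least) (use elim le in auto)
  qed
  ultimately show ?thesis
    by (rule tendsto_sandwich[OF _ _ tendsto_const affine_ln_over_n_tendsto_0])
qed

text \<open>With p the integer part of n t, the deviation splits into three parts of size e/3: the
  fluctuation around the mean, small off the bad event; the error of the mean, at most O(ln n / n);
  and the oscillation of \<open>J_rate\<close> between 1 - p/n and 1 - t.\<close>

lemma log_Delta_t_uniform_in_probability:
  assumes e: "e > 0"
  shows "(\<lambda>n. prob {x \<in> space M.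
      (SUP t\<in>{0..1}. \<bar>(1 / real n) * log_Delta_t \<rho> n t x + J_rate (1 - t)\<bar>) > e}) \<longlonglongrightarrow> 0"
proof -
  have b: "\<beta> / 2 > 0" using beta_pos by simp
  obtain C D where CD: "\<And>n p. 0 < n \<Longrightarrow> p \<le> n \<Longrightarrow>
      \<bar>mean_logdet (\<beta> / 2) n p + real n * J_rate (1 - real p / real n)\<bar> \<le> C + D * ln (real n)"
    by (rule mean_logdet_uniform_bound[OF b]) blast
  obtain d where d: "d > 0"
    "\<And>u v. u \<in> {0..1} \<Longrightarrow> v \<in> {0..1} \<Longrightarrow> \<bar>u - v\<bar> < d \<Longrightarrow> \<bar>J_rate u - J_rate v\<bar> < e / 3"
    using J_rate_uniform_modulus[of "e / 3"] e by auto
  let ?B = "\<lambda>n. \<Union>p\<in>{1..n}. {x \<in> space M. \<bar>log_Delta \<rho> n p x - mean_logdet (\<beta> / 2) n p\<bar> \<ge> e / 3 * real n}"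
  have "\<forall>\<^sub>F n in sequentially. (C + D * ln (real n)) / real n < e / 3"
    using order_tendstoD(2)[OF affine_ln_over_n_tendsto_0, of "e / 3"] e by simp
  moreover have "\<forall>\<^sub>F n in sequentially. 1 / real n < d"
    using order_tendstoD(2)[OF lim_1_over_n, of d] d(1) by simp
  ultimately have "\<forall>\<^sub>F n in sequentially. prob {x \<in> space M.
      (SUP t\<in>{0..1}. \<bar>(1 / real n) * log_Delta_t \<rho> n t x + J_rate (1 - t)\<bar>) > e}
      \<le> var_logdet (\<beta> / 2) n n / real n / (e / 3)\<^sup>2"
    using eventually_gt_at_top[of 0]
  proof eventually_elim
    case (elim n)
    have "\<bar>(1 / real n) * log_Delta_t \<rho> n t x + J_rate (1 - t)\<bar> \<le> e"
      if x: "x \<in> space M" "x \<notin> ?B n" and t: "t \<in> {0..1}" for x t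
    proof -
      define p where "p = nat \<lfloor>real n * t\<rfloor>"
      have p: "p \<le> n" unfolding p_def using t by (intro nat_floor_mult_le) auto
      have "\<bar>log_Delta \<rho> n p x - mean_logdet (\<beta> / 2) n p\<bar> \<le> e / 3 * real n"
      proof (cases "p = 0")
        case True
        then show ?thesis using e by (simp add: log_Delta_def mean_logdet_def)
      next
        case False
        then show ?thesis using x p by (auto simp: not_le intro: less_imp_le)
      qed
      then have 1: "\<bar>(log_Delta \<rho> n p x - mean_logdet (\<beta> / 2) n p) / real n\<bar> \<le> e / 3"
        using elim by (simp add: field_simps)
      have "\<bar>(mean_logdet (\<beta> / 2) n p + real n * J_rate (1 - real p / real n)) / real n\<bar>
          \<le> (C + D * ln (real n)) / real n"
        using CD[of n p] p elim by (simp add: divide_right_mono)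
      with elim have 2: "\<bar>(mean_logdet (\<beta> / 2) n p + real n * J_rate (1 - real p / real n)) / real n\<bar> \<le> e / 3"
        by linarith
      have "real p \<le> real n * t" "real n * t < real p + 1"
        using t elim unfolding p_def by (simp, linarith)
      then have "real p / real n \<le> t" "(real n * t) / real n < (real p + 1) / real n"
        using elim by (auto simp: field_simps intro!: divide_strict_right_mono)
      then have "real p / real n \<le> t" "t - real p / real n < 1 / real n"
        using elim by (simp_all add: add_divide_distrib)
      then have "\<bar>(1 - t) - (1 - real p / real n)\<bar> < d" using elim by linarith
      then have 3: "\<bar>J_rate (1 - t) - J_rate (1 - real p / real n)\<bar> < e / 3"
        using p t elim by (intro d(2)) auto
      have "(1 / real n) * log_Delta_t \<rho> n t x + J_rate (1 - t) =
          (log_Delta \<rho> n p x - mean_logdet (\<beta> / 2) n p) / real n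
          + (mean_logdet (\<beta> / 2) n p + real n * J_rate (1 - real p / real n)) / real n
          + (J_rate (1 - t) - J_rate (1 - real p / real n))"
        using elim by (simp add: log_Delta_t_def p_def add_divide_distrib diff_divide_distrib)
      with 1 2 3 show ?thesis by linarith
    qed
    then have "(SUP t\<in>{0..1}. \<bar>(1 / real n) * log_Delta_t \<rho> n t x + J_rate (1 - t)\<bar>) \<le> e"
      if "x \<in> space M" "x \<notin> ?B n" for x
      using that by (intro cSUP_least) auto
    then have "{x \<in> space M. (SUP t\<in>{0..1}. \<bar>(1 / real n) * log_Delta_t \<rho> n t x + J_rate (1 - t)\<bar>) > e} \<subseteq> ?B n"
      by (blast dest: leD)
    \<comment> \<open>Monotonicity asks for measurability of the larger event only, a finite union;
      the event with the uncountable supremum is just contained in it.\<close>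
    then have "prob {x \<in> space M. (SUP t\<in>{0..1}. \<bar>(1 / real n) * log_Delta_t \<rho> n t x + J_rate (1 - t)\<bar>) > e}
        \<le> prob (?B n)"
      using log_Delta_moments(4) by (intro finite_measure_mono) auto
    also have "\<dots> \<le> var_logdet (\<beta> / 2) n n / real n / (e / 3)\<^sup>2"
      using prob_max_deviation_le[of n "e / 3"] elim e by simp
    finally show ?case .
  qed
  moreover have "(\<lambda>n. var_logdet (\<beta> / 2) n n / real n / (e / 3)\<^sup>2) \<longlonglongrightarrow> 0"
    using tendsto_divide[OF var_logdet_over_n_tendsto_0 tendsto_const[of "(e / 3)\<^sup>2"]] e by simp
  ultimately show ?thesis
    by (rule tendsto_sandwich[OF always_eventually _ tendsto_const, rotated]) simp
qed

end

theorem theorem3p1: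
  fixes M :: "'a measure" and \<beta> :: real and \<rho> :: "nat \<Rightarrow> nat \<Rightarrow> 'a \<Rightarrow> real"
  assumes beta_pos: "\<beta> > 0"
    and M: "prob_space M"
    and rho1: "\<And>n x. n \<ge> 1 \<Longrightarrow> x \<in> space M \<Longrightarrow> \<rho> n 1 x = 1"
    and rho_distr: "\<And>n k. 2 \<le> k \<Longrightarrow> k \<le> n \<Longrightarrow>
        distributed M lborel (\<rho> n k)
          (\<lambda>x. ennreal (beta_density (\<beta> / 2 * real (n - k + 1)) (\<beta> / 2 * real (k - 1)) x))"
    and rho_indep: "\<And>n. prob_space.indep_vars M (\<lambda>_. borel) (\<rho> n) {2..n}"
  shows
    "(\<lambda>n. SUP p\<in>{1..n}. \<bar>(1 / real n) * (\<integral>x. log_Delta \<rho> n p x \<partial>M)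
                          + J_rate (1 - real p / real n)\<bar>) \<longlonglongrightarrow> 0
   \<and> (\<forall>t\<in>{0..<1}.
        (\<lambda>n. (\<integral>x. log_Delta_t \<rho> n t x \<partial>M)
              + real n * J_rate (1 - real (nat \<lfloor>real n * t\<rfloor>) / real n))
        \<longlonglongrightarrow> integral {0..t} (d_G \<beta>))
   \<and> (\<lambda>n. (\<integral>x. log_Delta_t \<rho> n 1 x \<partial>M) + real n + (1/\<beta> - 1/2) * ln (real n))
        \<longlonglongrightarrow> K1 \<beta>
   \<and> (\<forall>t\<in>{0..<1}.
        (\<lambda>n. \<integral>x. (log_Delta_t \<rho> n t x - (\<integral>y. log_Delta_t \<rho> n t y \<partial>M))\<^sup>2 \<partial>M)
        \<longlonglongrightarrow> integral {0..t} (\<lambda>s. (sigma_G \<beta> s)\<^sup>2))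
   \<and> (\<lambda>n. (\<integral>x. (log_Delta_t \<rho> n 1 x - (\<integral>y. log_Delta_t \<rho> n 1 y \<partial>M))\<^sup>2 \<partial>M)
           - 2 / \<beta> * ln (real n)) \<longlonglongrightarrow> K2 \<beta>
   \<and> (\<forall>\<epsilon>>0. (\<lambda>n. measure M {x \<in> space M.
          (SUP t\<in>{0..1}. \<bar>(1 / real n) * log_Delta_t \<rho> n t x + J_rate (1 - t)\<bar>) > \<epsilon>})
        \<longlonglongrightarrow> 0)"
proof -
  interpret prob_space M by (rule M)
  have b: "\<beta> / 2 > 0" using beta_pos by simp
  note ctx = beta_pos M rho1 rho_distr rho_indep
  have t_moments: "expectation (log_Delta_t \<rho> n t) = mean_logdet (\<beta> / 2) n (nat \<lfloor>real n * t\<rfloor>)"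
    "variance (log_Delta_t \<rho> n t) = var_logdet (\<beta> / 2) n (nat \<lfloor>real n * t\<rfloor>)"
    if "t \<in> {0..1}" for n t
    using log_Delta_moments(1,2)[OF ctx, of "nat \<lfloor>real n * t\<rfloor>" n] nat_floor_mult_le[of t n] that
    by (simp_all add: log_Delta_t_def[abs_def])
  have "(\<lambda>n. expectation (log_Delta_t \<rho> n t) + real n * J_rate (1 - real (nat \<lfloor>real n * t\<rfloor>) / real n))
      \<longlonglongrightarrow> integral {0..t} (d_G \<beta>)"
    "(\<lambda>n. variance (log_Delta_t \<rho> n t)) \<longlonglongrightarrow> integral {0..t} (\<lambda>s. (sigma_G \<beta> s)\<^sup>2)"
    if t: "t \<in> {0..<1}" for t
  proof -
    have t': "t \<in> {0..1}" and t'': "0 \<le> t" "t < 1" using t by auto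
    show "(\<lambda>n. expectation (log_Delta_t \<rho> n t) + real n * J_rate (1 - real (nat \<lfloor>real n * t\<rfloor>) / real n))
      \<longlonglongrightarrow> integral {0..t} (d_G \<beta>)"
      unfolding t_moments(1)[OF t'] integral_d_G[OF t'' beta_pos]
      using mean_logdet_bulk_LIMSEQ[OF t'' b] by simp
    show "(\<lambda>n. variance (log_Delta_t \<rho> n t)) \<longlonglongrightarrow> integral {0..t} (\<lambda>s. (sigma_G \<beta> s)\<^sup>2)"
      unfolding t_moments(2)[OF t'] integral_sigma_G[OF t'' beta_pos]
      using var_logdet_bulk_LIMSEQ[OF t'' b] by (simp add: field_simps)
  qed
  moreover have one: "(1::real) \<in> {0..1}" by simp
  \<comment> \<open>At t = 1 the integer part of n t is n itself, and b = \<beta>/2 turns 1/(2b)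
    into 1/\<beta>, so the edge limit has exactly the form of \<open>K1\<close>.\<close>
  moreover have "(\<lambda>n. expectation (log_Delta_t \<rho> n 1) + real n + (1 / \<beta> - 1 / 2) * ln (real n)) \<longlonglongrightarrow> K1 \<beta>"
    using mean_logdet_edge_LIMSEQ[OF b] by (simp add: t_moments K1_def)
  moreover have "(\<lambda>n. variance (log_Delta_t \<rho> n 1) - 2 / \<beta> * ln (real n)) \<longlonglongrightarrow> K2 \<beta>"
    using var_logdet_edge_LIMSEQ[OF b] unfolding t_moments(2)[OF one]
    by (simp add: K2_def mult_ac)
  ultimately show ?thesis
    using mean_uniform_LIMSEQ[OF ctx] log_Delta_t_uniform_in_probability[OF ctx] by blast
qed

end
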